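(* Let $A$ and $B$ be nontrivial commutative torsion groups such that $\exp(A[p^\infty])$ is finite for every prime $p$. (a) $\delta^\circ(A,B)=\sup_{p}\delta^\circ(A[p^\infty],B[p^\infty])$, the supremum over all primes $p$. (b) If there are infinitely many primes $p$ such that $A[p^\infty]$ and $B[p^\infty]$ are both nonzero, then $\delta^\circ(A,B)=\infty$. (c) If there is a prime $p$ with $A[p^\infty]\neq 0$ and $B[p^\infty]$ of infinite exponent, then $\delta^\circ(A,B)=\infty$. (d) If there is a prime $p$ with $A[p^\infty]$ infinite and $B[p^\infty]\ne 0$, then $\delta^\circ(A,B)=\infty$. (e) Otherwise, i.e. if the set $P$ of primes $p$ for which $A[p^\infty]$ and $B[p^\infty]$ are both nonzero is finite, and for each $p\in P$ the group $A[p^\infty]$ is finite and $B[p^\infty]$ has finite exponent, then $\delta^\circ(A,B)$ is finite; explicitly, writing for $p\in P$ $A[p^\infty]\cong\bigoplus_{i=1}^{r_p}\mathbb{Z}/p^{\alpha_{p,i}}\mathbb{Z}$ with $\alpha_{p,1}\ge\dots\ge\alpha_{p,r_p}\ge1$ and $\exp(B[p^\infty])=p^{\beta_p}$, we have $\delta^\circ(A,B)=\max\big(\{0\}\cup\{\sum_{i=1}^{r_p}(p^{\alpha_{p,i}}-1)+(\beta_p-1)(p-1)p^{\alpha_{p,1}-1}: p\in P\}\big)$.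
   Context: For commutative groups $A,B$, $B^A$ denotes the commutative group (under pointwise addition) of all maps $A\to B$. For $a\in A$, the difference operator $\Delta_a:B^A\to B^A$ is $(\Delta_a f)(x)=f(x+a)-f(x)$. Let $\widetilde{\mathbb N}=\mathbb N\cup\{-\infty,\infty\}$ ($\mathbb N=\{0,1,2,\dots\}$), totally ordered with $-\infty$ least and $\infty$ greatest. The functional degree $\operatorname{fdeg}(f)\in\widetilde{\mathbb N}$ of $f\in B^A$ is: $-\infty$ if $f=0$; otherwise the least $n\in\mathbb N$ such that $\Delta_{a_1}\cdots\Delta_{a_{n+1}}f=0$ for all $a_1,\dots,a_{n+1}\in A$; and $\infty$ if no such $n$ exists. Define $\delta^\circ(A,B)=\sup\{\operatorname{fdeg}(f): f\in B^A,\ \operatorname{fdeg}(f)<\infty\}$ (supremum in $\widetilde{\mathbb N}$). For a prime $p$, $A[p^\infty]=\{x\in A: p^kx=0\text{ for some }k\ge1\}$. The exponent $\exp(G)$ of a group is the least $n\ge1$ with $nG=0$, or $\infty$ if none exists. *)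

theory Defs
  imports "HOL-Library.Extended_Real" "HOL-Library.Extended_Nat" "HOL-Computational_Algebra.Primes"
begin

definition nsmul :: "nat \<Rightarrow> 'a::ab_group_add \<Rightarrow> 'a" where
  "nsmul n x = (((+) x) ^^ n) 0"

definition diffop :: "'a::ab_group_add \<Rightarrow> ('a \<Rightarrow> 'b::ab_group_add) \<Rightarrow> ('a \<Rightarrow> 'b)" where
  "diffop a f = (\<lambda>x. f (x + a) - f x)"

definition diffs :: "'a::ab_group_add list \<Rightarrow> ('a \<Rightarrow> 'b::ab_group_add) \<Rightarrow> ('a \<Rightarrow> 'b)" where
  "diffs as f = foldr diffop as f"

definition fdeg_le :: "'a::ab_group_add set \<Rightarrow> ('a \<Rightarrow> 'b::ab_group_add) \<Rightarrow> nat \<Rightarrow> bool" where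
  "fdeg_le S f n \<longleftrightarrow>
     (\<forall>as. length as = Suc n \<and> set as \<subseteq> S \<longrightarrow> (\<forall>x\<in>S. diffs as f x = 0))"

text \<open>Functional degree, valued in ereal (only the values -\<infinity>, naturals, \<infinity> occur;
  this is the order-embedding of N~ = N \<union> {-\<infinity>,\<infinity>}).\<close>
definition fdeg :: "'a::ab_group_add set \<Rightarrow> ('a \<Rightarrow> 'b::ab_group_add) \<Rightarrow> ereal" where
  "fdeg S f =
     (if (\<forall>x\<in>S. f x = 0) then -\<infinity>
      else if (\<exists>n. fdeg_le S f n) then ereal (real (LEAST n. fdeg_le S f n))
      else \<infinity>)"

definition delta0 :: "'a::ab_group_add set \<Rightarrow> 'b::ab_group_add set \<Rightarrow> ereal" where
  "delta0 S T = Sup {fdeg S f | f :: 'a \<Rightarrow> 'b. f ` S \<subseteq> T \<and> fdeg S f < \<infinity>}"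

definition ppart :: "nat \<Rightarrow> 'a::ab_group_add set" where
  "ppart p = {x. \<exists>k\<ge>1. nsmul (p ^ k) x = 0}"

definition torsion_group :: "'a::ab_group_add itself \<Rightarrow> bool" where
  "torsion_group _ \<longleftrightarrow> (\<forall>x::'a. \<exists>n\<ge>1. nsmul n x = 0)"

definition gexp :: "'a::ab_group_add set \<Rightarrow> enat" where
  "gexp S = (if (\<exists>n\<ge>1. \<forall>x\<in>S. nsmul n x = 0)
             then enat (LEAST n. n \<ge> 1 \<and> (\<forall>x\<in>S. nsmul n x = 0)) else \<infinity>)"

text \<open>S is isomorphic to the direct sum of Z/p^(as!i) Z, i < length as: there are elements
  g_i of S with p^(as!i) g_i = 0 such that (c_i) \<mapsto> \<Sum> c_i g_i is a bijection from
  \<Prod> {0..<p^(as!i)} onto S (this map is then a group isomorphism).\<close>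
definition cyclic_decomp :: "'a::ab_group_add set \<Rightarrow> nat \<Rightarrow> nat list \<Rightarrow> bool" where
  "cyclic_decomp S p as \<longleftrightarrow>
     (\<exists>g :: nat \<Rightarrow> 'a.
        (\<forall>i<length as. g i \<in> S \<and> nsmul (p ^ (as ! i)) (g i) = 0) \<and>
        bij_betw (\<lambda>c. \<Sum>i<length as. nsmul (c i) (g i))
          {c. \<forall>i. (i < length as \<longrightarrow> c i < p ^ (as ! i)) \<and> (length as \<le> i \<longrightarrow> c i = 0)} S)"

end

theory Submission
  imports Defs "HOL-Computational_Algebra.Polynomial" "HOL-Library.Multiset"
begin

text \<open>
  Iterated differences of \<open>f\<close> are the action of powers of the augmentation ideal \<open>I\<close> of the group
  ring on \<open>f\<close>, so the maximal degree measures how far \<open>I\<^sup>n\<close> is from zero. For a generator \<open>g\<close> of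
  order \<open>q = p\<^sup>a\<close>, put \<open>X = g - 1\<close> and \<open>\<phi> = (p - 1) p^(a - 1)\<close>. Since \<open>(1 + X)^q - 1\<close> has the
  \<open>q\<close>-th cyclotomic factor \<open>X^\<phi> + p (1 + X h)\<close>, in the group ring of \<open>g\<close> we have
  \<open>X^(q + b \<phi>) = 0\<close> modulo \<open>p^(b + 1)\<close> and \<open>X^(q - 1 + b \<phi>) = (-p)^b X^(q - 1)\<close> modulo
  \<open>p^(b + 1)\<close>. The first congruence bounds the degree from above for every finite \<open>p\<close>-group; the
  second one, applied to the indicator function of zero, shows that the bound is attained.

  A map of finite degree from a torsion group into a \<open>q\<close>-primary group is constant along elements of
  order prime to \<open>q\<close>, so everything splits into primary components. The infinite cases come from the
  same lower bound for maps that factor through an elementary abelian quotient of \<open>A[p^\<infinity>]\<close>, which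
  exists because the exponent is finite.
\<close>

section \<open>Integer multiples\<close>

lemma nsmul_0 [simp]: "nsmul 0 x = 0"
  by (simp add: nsmul_def)

lemma nsmul_Suc: "nsmul (Suc n) x = x + nsmul n x"
  by (simp add: nsmul_def)

lemma nsmul_add: "nsmul (m + n) x = nsmul m x + nsmul n x"
  by (induction m) (simp_all add: nsmul_Suc add.assoc)

lemma nsmul_distrib: "nsmul n (x + y) = nsmul n x + nsmul n y"
  by (induction n) (simp_all add: nsmul_Suc algebra_simps)

lemma nsmul_zero [simp]: "nsmul n 0 = 0"
  by (induction n) (simp_all add: nsmul_Suc)

lemma nsmul_minus: "nsmul n (- x) = - nsmul n x"
  by (induction n) (simp_all add: nsmul_Suc)

lemma nsmul_diff: "nsmul n (x - y) = nsmul n x - nsmul n y"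
  using nsmul_distrib[of n x "- y"] by (simp add: nsmul_minus)

lemma nsmul_mult: "nsmul (m * n) x = nsmul m (nsmul n x)"
  by (induction m) (simp_all add: nsmul_Suc nsmul_add)

lemma nsmul_1 [simp]: "nsmul (Suc 0) x = x"
  by (simp add: nsmul_Suc)

text \<open>Integer scaling makes every commutative group a module over the integers, so that
  library submodules and spans serve as subgroups and generated subgroups.\<close>

definition zsmul :: "int \<Rightarrow> 'a::ab_group_add \<Rightarrow> 'a" where
  "zsmul k x = nsmul (nat k) x - nsmul (nat (- k)) x"

lemma zsmul_diff_of_nat: "zsmul (int m - int n) x = nsmul m x - nsmul n x"
proof (cases "n \<le> m")
  case True
  then obtain k where "m = n + k" using le_Suc_ex by blast
  then show ?thesis by (simp add: zsmul_def nsmul_add)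
next
  case False
  then obtain k where "n = m + k" using le_Suc_ex[of m n] by auto
  then show ?thesis by (simp add: zsmul_def nsmul_add)
qed

lemma zsmul_of_nat [simp]: "zsmul (int n) x = nsmul n x"
  using zsmul_diff_of_nat[of n 0 x] by simp

interpretation zsmul: module zsmul
proof
  fix a b :: int and x y :: 'a
  \<comment> \<open>Writing integers as differences of naturals avoids case distinctions on
    signs.\<close>
  obtain m n where a: "a = int m - int n" by (cases a rule: int_diff_cases)
  obtain k l where b: "b = int k - int l" by (cases b rule: int_diff_cases)
  show "zsmul a (x + y) = zsmul a x + zsmul a y"
    by (simp add: a zsmul_diff_of_nat nsmul_distrib)
  have "a + b = int (m + k) - int (n + l)" by (simp add: a b)
  then show "zsmul (a + b) x = zsmul a x + zsmul b x"
    by (simp only: zsmul_diff_of_nat) (simp add: a b zsmul_diff_of_nat nsmul_add)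
  have "a * b = int (m * k + n * l) - int (m * l + n * k)" by (simp add: a b algebra_simps)
  then show "zsmul a (zsmul b x) = zsmul (a * b) x"
    by (simp only: zsmul_diff_of_nat) (simp add: a b zsmul_diff_of_nat nsmul_add nsmul_mult nsmul_diff)
  show "zsmul 1 x = x" by (simp add: zsmul_def)
qed

text \<open>Scaling by an integer is repeated addition and negation, so closure under these is all
  that a submodule needs.\<close>

lemma zsmul_subspaceI:
  assumes "0 \<in> S" and add: "\<And>x y. x \<in> S \<Longrightarrow> y \<in> S \<Longrightarrow> x + y \<in> S"
    and neg: "\<And>x. x \<in> S \<Longrightarrow> - x \<in> S"
  shows "zsmul.subspace S"
proof -
  have n: "nsmul n x \<in> S" if "x \<in> S" for n x
    by (induction n) (use that assms in \<open>auto simp: nsmul_Suc\<close>)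
  have "zsmul c x \<in> S" if "x \<in> S" for c x
    unfolding zsmul_def using add[OF n[OF that] neg[OF n[OF that]]] by simp
  with assms show ?thesis by (simp add: zsmul.subspace_def)
qed

lemma nsmul_in_subspace: "zsmul.subspace S \<Longrightarrow> x \<in> S \<Longrightarrow> nsmul n x \<in> S"
  using zsmul.subspace_scale[of S x "int n"] by simp

lemma zsmul_eq_0_dvd: "nsmul n x = 0 \<Longrightarrow> int n dvd k \<Longrightarrow> zsmul k x = 0"
  by (auto simp: dvd_def zsmul.scale_scale[symmetric] mult.commute[of "int n"])

lemma coprime_int_combination:
  assumes "coprime m n"
  obtains u v where "u * int m + v * int n = 1"
proof -
  have "gcd (int m) (int n) = 1" using assms by (simp flip: coprime_iff_gcd_eq_1)
  then show thesis using bezout_int[of "int m" "int n"] that by auto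
qed

text \<open>By a Bezout identity, \<open>x\<close> is an integer combination of
  \<open>nsmul m x\<close> and \<open>nsmul n x\<close>.\<close>

lemma coprime_nsmul_mem:
  assumes S: "zsmul.subspace S" and "coprime m n" "nsmul m x \<in> S" "nsmul n x \<in> S"
  shows "x \<in> S"
proof -
  obtain u v where uv: "u * int m + v * int n = 1"
    using coprime_int_combination[OF assms(2)] .
  have "x = zsmul (u * int m + v * int n) x" by (simp add: uv)
  also have "\<dots> = zsmul u (nsmul m x) + zsmul v (nsmul n x)"
    by (simp add: zsmul.scale_left_distrib zsmul.scale_scale[symmetric])
  finally show ?thesis
    using S assms(3,4) by (metis zsmul.subspace_add zsmul.subspace_scale)
qed

lemma coprime_nsmul_eq_0:
  "coprime m n \<Longrightarrow> nsmul m x = 0 \<Longrightarrow> nsmul n x = 0 \<Longrightarrow> x = 0"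
  using coprime_nsmul_mem[of "{0}" m n x] zsmul.subspace_single_0 by auto

section \<open>Iterated differences\<close>

lemma diffs_Nil [simp]: "diffs [] f = f"
  by (simp add: diffs_def)

lemma diffs_Cons: "diffs (a # as) f = diffop a (diffs as f)"
  by (simp add: diffs_def)

lemma diffs_append: "diffs (as @ bs) f = diffs as (diffs bs f)"
  by (simp add: diffs_def)

lemma diffop_commute: "diffop a (diffop b f) = diffop b (diffop a f)"
  by (simp add: diffop_def fun_eq_iff algebra_simps)

lemma diffs_diffop: "diffs as (diffop b f) = diffop b (diffs as f)"
  by (induction as) (simp_all add: diffs_Cons diffop_commute)

text \<open>Difference operators commute, so only the multiset of directions matters; later this
  allows equal generators to be collected.\<close>

lemma diffs_mset_cong: "mset as = mset bs \<Longrightarrow> diffs as f = diffs bs f"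
proof (induction as arbitrary: bs)
  case (Cons a as)
  then have "a \<in> set bs" by (metis list.set_intros(1) mset_eq_setD)
  then obtain us vs where bs: "bs = us @ a # vs" by (meson split_list)
  with Cons.prems have "mset as = mset (us @ vs)" by simp
  then have "diffs as f = diffs (us @ vs) f" by (rule Cons.IH)
  then show ?case by (simp add: bs diffs_Cons diffs_append diffs_diffop)
qed simp

lemma diffs_zero [simp]: "diffs as (\<lambda>x. 0) = (\<lambda>x. 0)"
  by (induction as) (simp_all add: diffs_Cons diffop_def)

lemma diffs_add: "diffs as (\<lambda>x. f x + h x) = (\<lambda>x. diffs as f x + diffs as h x)"
  by (induction as) (simp_all add: diffs_Cons diffop_def fun_eq_iff algebra_simps)

lemma diffs_hom_left:
  assumes "\<And>x y. \<phi> (x - y) = \<phi> x - \<phi> y"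
  shows "diffs as (\<lambda>x. \<phi> (f x)) = (\<lambda>x. \<phi> (diffs as f x))"
  by (induction as) (simp_all add: diffs_Cons diffop_def fun_eq_iff assms)

lemma diffs_hom_right:
  assumes "\<And>x y. \<phi> (x + y) = \<phi> x + \<phi> y"
  shows "diffs as (\<lambda>x. f (\<phi> x)) = (\<lambda>x. diffs (map \<phi> as) f (\<phi> x))"
  by (induction as) (simp_all add: diffs_Cons diffop_def fun_eq_iff assms)

lemma diffs_zsmul: "diffs as (\<lambda>x. zsmul c (f x)) = (\<lambda>x. zsmul c (diffs as f x))"
  by (rule diffs_hom_left) (rule zsmul.scale_right_diff_distrib)

lemma diffs_shift: "diffs as (\<lambda>x. f (x + b)) = (\<lambda>x. diffs as f (x + b))"
  by (induction as) (simp_all add: diffs_Cons diffop_def fun_eq_iff algebra_simps)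

lemma diffs_cong:
  assumes S: "zsmul.subspace S" and "\<And>x. x \<in> S \<Longrightarrow> f x = h x" "set as \<subseteq> S" "x \<in> S"
  shows "diffs as f x = diffs as h x"
  using assms(3,4)
  by (induction as arbitrary: x)
     (auto simp: diffs_Cons diffop_def assms(2) zsmul.subspace_add[OF S])

text \<open>Since \<open>\<Delta>\<^bsub>a+b\<^esub> f = (\<Delta>\<^bsub>a\<^esub> f)(\<cdot> + b) + \<Delta>\<^bsub>b\<^esub> f\<close>, the directions along which every difference lowers
  the degree form a subgroup.\<close>
lemma diffs_span_eq_0:
  assumes "\<And>as. length as = n \<Longrightarrow> set as \<subseteq> G \<Longrightarrow> diffs as f = (\<lambda>x. 0)"
    and "length as = n" "set as \<subseteq> zsmul.span G"
  shows "diffs as f = (\<lambda>x. 0)"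
  using assms
proof (induction n arbitrary: f as)
  case (Suc n)
  define H where "H = {a. \<forall>as. length as = n \<and> set as \<subseteq> G \<longrightarrow> diffs as (diffop a f) = (\<lambda>x. 0)}"
  have plus: "diffs as (diffop (a + b) f) x = diffs as (diffop a f) (x + b) + diffs as (diffop b f) x"
    for as a b x
  proof -
    have "diffop (a + b) f = (\<lambda>x. diffop a f (x + b) + diffop b f x)"
      by (simp add: diffop_def fun_eq_iff add_ac)
    then show ?thesis by (simp add: diffs_add diffs_shift)
  qed
  have zero: "diffop 0 f = (\<lambda>x. 0)"
    by (simp add: diffop_def)
  have "zsmul.subspace H"
  proof (rule zsmul_subspaceI)
    show "0 \<in> H" by (simp add: H_def zero)
    show "a + b \<in> H" if "a \<in> H" "b \<in> H" for a b
      using that by (auto simp: H_def fun_eq_iff plus)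
    show "- a \<in> H" if a: "a \<in> H" for a
    proof -
      have "diffs as (diffop (- a) f) x = 0" if "length as = n" "set as \<subseteq> G" for as x
        using plus[of as a "- a" x] a that by (simp add: H_def zero)
      then show ?thesis by (auto simp: H_def fun_eq_iff)
    qed
  qed
  moreover have "G \<subseteq> H"
  proof
    fix a assume a: "a \<in> G"
    have "diffs as (diffop a f) = (\<lambda>x. 0)" if "length as = n" "set as \<subseteq> G" for as
      using Suc.prems(1)[of "as @ [a]"] that a by (simp add: diffs_append diffs_Cons)
    then show "a \<in> H" by (simp add: H_def)
  qed
  ultimately have H: "zsmul.span G \<subseteq> H" by (rule zsmul.span_minimal[rotated])
  obtain a bs where as: "as = a # bs" using Suc.prems(2) by (cases as) auto
  \<comment> \<open>So far only one direction ranges over the span; the induction hypothesis for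
    \<open>diffop a f\<close> frees the remaining ones.\<close>
  have "diffs bs (diffop a f) = (\<lambda>x. 0)"
  proof (rule Suc.IH)
    fix cs assume "length cs = n" "set cs \<subseteq> G"
    moreover have "a \<in> H" using H Suc.prems(3) as by auto
    ultimately show "diffs cs (diffop a f) = (\<lambda>x. 0)" by (simp add: H_def)
  qed (use Suc.prems as in auto)
  then show ?case by (simp add: as diffs_Cons diffs_diffop)
qed simp

section \<open>Functional degree\<close>

lemma fdeg_le_Suc:
  assumes S: "zsmul.subspace S" and f: "fdeg_le S f n"
  shows "fdeg_le S f (Suc n)"
  unfolding fdeg_le_def
proof (intro allI impI ballI)
  fix as x assume as: "length as = Suc (Suc n) \<and> set as \<subseteq> S" and x: "x \<in> S"
  then obtain a bs where "as = a # bs" by (cases as) auto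
  with as x f show "diffs as f x = 0"
    by (auto simp: diffs_Cons diffop_def fdeg_le_def zsmul.subspace_add[OF S])
qed

lemma fdeg_le_mono:
  assumes "m \<le> n" "zsmul.subspace S" "fdeg_le S f m"
  shows "fdeg_le S f n"
  using assms by (induction rule: dec_induct) (auto intro: fdeg_le_Suc)

lemma fdeg_le_cong:
  "zsmul.subspace S \<Longrightarrow> (\<And>x. x \<in> S \<Longrightarrow> f x = h x) \<Longrightarrow> fdeg_le S f n = fdeg_le S h n"
  unfolding fdeg_le_def using diffs_cong[of S f h] by auto

lemma fdeg_le_imp_fdeg: "fdeg_le S f n \<Longrightarrow> fdeg S f \<le> ereal (real n)"
  by (auto simp: fdeg_def intro: Least_le)

text \<open>Degree bounds are monotone, so a bound below the length of the list would make this
  difference vanish; \<open>fdeg_le\<close> with bound \<open>n\<close> speaks of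
  \<open>Suc n\<close> differences.\<close>

lemma fdeg_geI:
  assumes S: "zsmul.subspace S" and as: "set as \<subseteq> S" "x \<in> S" and nz: "diffs as f x \<noteq> 0"
  shows "ereal (real (length as)) \<le> fdeg S f"
proof -
  have "\<not> (\<forall>x\<in>S. f x = 0)"
    using diffs_cong[OF S _ as, of f "\<lambda>x. 0"] nz by auto
  moreover have "length as \<le> n" if "fdeg_le S f n" for n
  proof (rule ccontr)
    assume "\<not> length as \<le> n"
    then have "fdeg_le S f (length as - 1)"
      using fdeg_le_mono[OF _ S that] by simp
    moreover have "length as = Suc (length as - 1)"
      using \<open>\<not> length as \<le> n\<close> by simp
    ultimately show False
      using as nz unfolding fdeg_le_def by blast
  qed
  then have "length as \<le> (LEAST n. fdeg_le S f n)" if "\<exists>n. fdeg_le S f n"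
    using LeastI_ex[OF that] by blast
  ultimately show ?thesis by (simp add: fdeg_def)
qed

lemma delta0_ge:
  "f ` S \<subseteq> T \<Longrightarrow> fdeg S f < \<infinity> \<Longrightarrow> fdeg S f \<le> delta0 S T"
  unfolding delta0_def by (intro Sup_upper) auto

lemma delta0_leI:
  "(\<And>f. f ` S \<subseteq> T \<Longrightarrow> fdeg S f < \<infinity> \<Longrightarrow> fdeg S f \<le> c) \<Longrightarrow> delta0 S T \<le> c"
  unfolding delta0_def by (intro Sup_least) auto

section \<open>Powers of the augmentation ideal of a cyclic \<open>p\<close>-group\<close>

text \<open>The prime divides the inner binomial coefficients. The factor \<open>a * b\<close> is
  kept because the error terms below must stay divisible by \<open>x\<close> or
  \<open>y\<close>.\<close>

lemma prime_power_sum: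
  fixes a b :: "'r::comm_ring_1"
  assumes p: "prime p"
  shows "\<exists>w. (a + b) ^ p = a ^ p + b ^ p + of_nat p * a * b * w"
proof -
  have p1: "0 < p" using p by (simp add: prime_gt_0_nat)
  have "\<exists>w. of_nat (p choose k) * a ^ k * b ^ (p - k) = of_nat p * a * b * w"
    if k: "k \<in> {1..<p}" for k
  proof -
    have "p dvd (p choose k)" using k p by (intro dvd_choose_prime) auto
    then obtain m where m: "p choose k = p * m" by (auto simp: dvd_def)
    obtain i where i: "k = Suc i" using k by (cases k) auto
    obtain j where j: "p - k = Suc j" using k by (cases "p - k") auto
    show ?thesis
      by (rule exI[of _ "of_nat m * a ^ i * b ^ j"]) (simp only: m i[symmetric] j, simp add: i mult_ac)
  qed
  then obtain w where w: "\<And>k. k \<in> {1..<p} \<Longrightarrow>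
      of_nat (p choose k) * a ^ k * b ^ (p - k) = of_nat p * a * b * w k" by metis
  have "{..p} = insert 0 (insert p {1..<p})" using p1 by auto
  then have "(a + b) ^ p = b ^ p + (a ^ p + (\<Sum>k\<in>{1..<p}. of_nat (p choose k) * a ^ k * b ^ (p - k)))"
    using p1 by (simp add: binomial_ring)
  also have "(\<Sum>k\<in>{1..<p}. of_nat (p choose k) * a ^ k * b ^ (p - k)) = of_nat p * a * b * sum w {1..<p}"
    using w by (simp add: sum_distrib_left)
  finally show ?thesis by (metis add.assoc add.commute)
qed

text \<open>The difference of two bases divides the difference of their powers.\<close>

lemma power_add_of_nat_mult:
  fixes a c :: "'r::comm_ring_1"
  shows "\<exists>w. (a + of_nat p * c) ^ n = a ^ n + of_nat p * c * w"
proof -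
  have "(a + of_nat p * c) - a dvd (a + of_nat p * c) ^ n - a ^ n"
    by (simp only: power_diff_sumr2) simp
  then obtain w where "(a + of_nat p * c) ^ n - a ^ n = of_nat p * c * w" by (auto simp: dvd_def)
  then show ?thesis by (metis add_diff_cancel_left' add_diff_eq)
qed

text \<open>Iterated Frobenius congruence: each step takes a \<open>p\<close>-th power, and the
  error keeps its factor \<open>x\<close>.\<close>

lemma prime_power_one_plus:
  fixes x :: "'r::comm_ring_1"
  assumes p: "prime p"
  shows "\<exists>w. (1 + x) ^ (p ^ m) = 1 + x ^ (p ^ m) + of_nat p * (x * w)"
proof (induction m)
  case 0
  show ?case by (rule exI[of _ 0]) simp
next
  case (Suc m)
  then obtain w where w: "(1 + x) ^ (p ^ m) = 1 + x ^ (p ^ m) + of_nat p * (x * w)" by blast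
  obtain u where u: "(1 + x ^ (p ^ m) + of_nat p * (x * w)) ^ p = (1 + x ^ (p ^ m)) ^ p + of_nat p * (x * w) * u"
    using power_add_of_nat_mult by blast
  obtain v where v: "(1 + x ^ (p ^ m)) ^ p = 1 + (x ^ (p ^ m)) ^ p + of_nat p * (x ^ (p ^ m)) * v"
    using prime_power_sum[OF p, of 1 "x ^ (p ^ m)"] by auto
  obtain i where i: "p ^ m = Suc i"
    using p by (metis not0_implies_Suc power_not_zero not_prime_0)
  have pow: "z ^ (p ^ Suc m) = (z ^ (p ^ m)) ^ p" for z :: 'r
    by (simp add: power_mult[symmetric] mult.commute)
  have "x ^ (p ^ m) = x * x ^ i" by (simp add: i)
  then have "(1 + x) ^ (p ^ Suc m) = 1 + x ^ (p ^ Suc m) + of_nat p * (x * (w * u + x ^ i * v))"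
    unfolding pow w u v by (simp add: algebra_simps)
  then show ?case by blast
qed

text \<open>With \<open>Y = 1 + X\<close>, \<open>\<Phi>\<close> is the cyclotomic polynomial of
  order \<open>p ^ (m + 1)\<close> in \<open>Y\<close>, the quotient of
  \<open>Y ^ (p * s) - 1\<close> by \<open>y = Y ^ s - 1\<close>. Expanding
  \<open>(1 + y) ^ p - 1\<close> and cancelling \<open>y\<close> gives
  \<open>\<Phi> = y ^ (p - 1) + p w\<close>, and \<open>w\<close> is \<open>1\<close> modulo
  \<open>X\<close>.\<close>

lemma cyclotomic_congruences:
  fixes p m :: nat
  assumes p: "prime p"
  defines "X \<equiv> [:-1, 1:] :: int poly" and "s \<equiv> p ^ m"
  obtains \<Phi> y h k where
    "[:0, 1:] ^ (p * s) - 1 = \<Phi> * y"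
    "\<Phi> = X ^ (s * (p - 1)) + of_nat p * (1 + X * h)"
    "y = X ^ s + of_nat p * (X * k)"
proof -
  define Y :: "int poly" where "Y = [:0, 1:]"
  have YX: "Y = 1 + X" by (simp add: Y_def X_def one_pCons)
  define y where "y = Y ^ s - 1"
  define \<Phi> where "\<Phi> = (\<Sum>j<p. (Y ^ s) ^ j)"
  have p2: "2 \<le> p" using p by (rule prime_ge_2_nat)
  have s0: "0 < s" using p by (simp add: s_def prime_gt_0_nat)
  obtain k where "(1 + X) ^ (p ^ m) = 1 + X ^ (p ^ m) + of_nat p * (X * k)"
    using prime_power_one_plus[OF p] by blast
  then have k: "y = X ^ s + of_nat p * (X * k)"
    by (simp add: y_def YX s_def)
  have pow: "Y ^ (p * s) = (Y ^ s) ^ p"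
    by (simp only: power_mult[symmetric] mult.commute)
  have "Y ^ (p * s) - 1 = y * \<Phi>"
    unfolding pow \<Phi>_def y_def by (rule power_diff_1_eq)
  then have M: "Y ^ (p * s) - 1 = \<Phi> * y" by (simp only: mult.commute)
  obtain w where w: "(1 + y) ^ p = 1 + y ^ p + of_nat p * y * w"
    using prime_power_sum[OF p, of 1 y] by auto
  have "y * \<Phi> = (1 + y) ^ p - 1"
    using M by (simp only: pow) (simp add: y_def mult.commute)
  also have "\<dots> = y ^ p + of_nat p * y * w" by (simp add: w)
  also have "y ^ p = y * y ^ (p - 1)" using p2 by (cases p) auto
  finally have "y * \<Phi> = y * (y ^ (p - 1) + of_nat p * w)" by (simp add: algebra_simps)
  \<comment> \<open>The value at zero shows that \<open>y\<close> is not the zero polynomial, so it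
    may be cancelled in the integral domain of integer polynomials.\<close>
  moreover have "poly (Y ^ s) 0 \<noteq> poly 1 0" using s0 by (simp add: Y_def power_0_left)
  then have "y \<noteq> 0" unfolding y_def by (metis eq_iff_diff_eq_0)
  ultimately have Phi: "\<Phi> = y ^ (p - 1) + of_nat p * w" by simp
  \<comment> \<open>Evaluation at \<open>1\<close>, the root of \<open>X\<close>, determines
    \<open>w\<close> modulo \<open>X\<close>: there \<open>\<Phi>\<close> is \<open>p\<close> and
    \<open>y\<close> vanishes, so \<open>w\<close> is \<open>1\<close>.\<close>
  have "poly y 1 = 0" by (simp add: y_def Y_def)
  moreover have "poly \<Phi> 1 = int p" by (simp add: \<Phi>_def Y_def poly_sum)
  ultimately have "poly w 1 = 1" using arg_cong[OF Phi, of "\<lambda>q. poly q 1"] p2 by (simp add: power_0_left)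
  then have "X dvd w - 1" by (simp add: X_def poly_eq_0_iff_dvd[symmetric])
  then obtain h0 where h0: "w = 1 + X * h0" by (metis dvdE add_diff_cancel_left' add_diff_eq)
  obtain v where v: "y ^ (p - 1) = (X ^ s) ^ (p - 1) + of_nat p * (X * k) * v"
    unfolding k using power_add_of_nat_mult by blast
  have "\<Phi> = X ^ (s * (p - 1)) + of_nat p * (1 + X * (h0 + k * v))"
    unfolding Phi v h0 by (simp add: power_mult[symmetric] algebra_simps)
  with M k show thesis by (intro that) (auto simp: Y_def)
qed

text \<open>Here \<open>c\<close> stands for the prime. Modulo \<open>\<Phi>\<close>,
  \<open>X ^ \<phi>\<close> is \<open>- c (1 + X h)\<close>, and modulo \<open>y\<close>,
  \<open>X ^ s\<close> is \<open>- c X k\<close>; so each further block of \<open>\<phi>\<close>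
  factors \<open>X\<close> is traded for one factor \<open>c\<close>.\<close>

lemma augmentation_power_congruences:
  fixes X :: "'r::comm_ring_1"
  assumes M: "M = \<Phi> * y"
    and Phi: "\<Phi> = X ^ \<phi> + c * (1 + X * h)"
    and y: "y = X ^ s + c * (X * k)"
    and s: "0 < s" "s \<le> \<phi>"
  shows augmentation_power_dvd: "\<exists>u. M dvd X ^ (\<phi> + s + b * \<phi>) - c ^ Suc b * u"
    and augmentation_power_eq:
      "\<exists>u. M dvd X ^ (\<phi> + s - 1 + b * \<phi>) - (- c) ^ b * X ^ (\<phi> + s - 1) - c ^ Suc b * u"
proof -
  \<comment> \<open>\<open>I b\<close> is the ideal generated by \<open>M\<close> and
    \<open>c ^ b\<close>.\<close>
  define I where "I b = {z. \<exists>u. M dvd z - c ^ b * u}" for b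
  have I_add: "z + w \<in> I b" if "z \<in> I b" "w \<in> I b" for z w b
  proof -
    from that obtain u v where "M dvd z - c ^ b * u" "M dvd w - c ^ b * v" by (auto simp: I_def)
    then have "M dvd (z - c ^ b * u) + (w - c ^ b * v)" by (rule dvd_add)
    moreover have "(z - c ^ b * u) + (w - c ^ b * v) = z + w - c ^ b * (u + v)" by (simp add: algebra_simps)
    ultimately show ?thesis by (auto simp: I_def)
  qed
  have I_mult: "w * z \<in> I b" if z: "z \<in> I b" for z w b
  proof -
    from z obtain u where "M dvd z - c ^ b * u" by (auto simp: I_def)
    then have "M dvd w * (z - c ^ b * u)" by simp
    moreover have "w * (z - c ^ b * u) = w * z - c ^ b * (w * u)" by (simp add: algebra_simps)
    ultimately show ?thesis by (auto simp: I_def)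
  qed
  have I_c: "c * z \<in> I (Suc b)" if z: "z \<in> I b" for z b
  proof -
    from z obtain u where "M dvd z - c ^ b * u" by (auto simp: I_def)
    then have "M dvd c * (z - c ^ b * u)" by simp
    moreover have "c * (z - c ^ b * u) = c * z - c ^ Suc b * u" by (simp add: algebra_simps)
    ultimately show ?thesis by (auto simp: I_def)
  qed
  have I_M: "M * z \<in> I b" for z b
    unfolding I_def by (auto intro!: exI[of _ 0])
  have I_pow: "c ^ b * z \<in> I b" for z b
    unfolding I_def by (auto intro!: exI[of _ z])
  have I_0: "z \<in> I 0" for z using I_pow[of 0 z] by simp
  have I_uminus: "- z \<in> I b" if "z \<in> I b" for z b using I_mult[OF that, of "-1"] by simp
  have X\<phi>: "X ^ \<phi> = \<Phi> - c * (1 + X * h)" using Phi by simp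
  have Xs: "X ^ s = y - c * (X * k)" using y by simp
  have P: "X ^ (\<phi> + s + b * \<phi>) \<in> I (Suc b)" for b
  proof (induction b)
    case 0
    have "X ^ (\<phi> + s) = M + c * (- (1 + X * h) * y - X * k * X ^ \<phi>)"
      unfolding power_add Xs M by (simp add: X\<phi> algebra_simps)
    with I_add[OF I_M[of 1] I_c[OF I_0]] show ?case by simp
  next
    case (Suc b)
    \<comment> \<open>Modulo \<open>\<Phi>\<close> the power of \<open>X ^ \<phi>\<close> becomes a
      power of \<open>- c (1 + X h)\<close>; multiplication by \<open>y\<close> then completes
      \<open>\<Phi>\<close> to \<open>M\<close>.\<close>
    have "(\<Phi> - c * (1 + X * h)) - (- c * (1 + X * h)) dvd
        (\<Phi> - c * (1 + X * h)) ^ Suc (Suc b) - (- c * (1 + X * h)) ^ Suc (Suc b)"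
      by (simp only: power_diff_sumr2) simp
    then have "\<Phi> dvd (\<Phi> - c * (1 + X * h)) ^ Suc (Suc b) - (- c * (1 + X * h)) ^ Suc (Suc b)"
      by simp
    then obtain w where w: "(\<Phi> - c * (1 + X * h)) ^ Suc (Suc b) - (- c * (1 + X * h)) ^ Suc (Suc b) = \<Phi> * w" ..
    have "X ^ (Suc (Suc b) * \<phi>) = (\<Phi> - c * (1 + X * h)) ^ Suc (Suc b)"
      unfolding X\<phi>[symmetric] by (simp only: power_mult[symmetric] mult.commute)
    then have w': "X ^ (Suc (Suc b) * \<phi>) = (- c * (1 + X * h)) ^ Suc (Suc b) + \<Phi> * w"
      using w by (simp add: algebra_simps)
    have "(- c * (1 + X * h)) ^ Suc (Suc b) = c ^ Suc (Suc b) * (- (1 + X * h)) ^ Suc (Suc b)"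
      by (simp only: power_mult_distrib[symmetric]) (simp only: mult_minus_left mult_minus_right)
    then have 1: "y * X ^ (Suc (Suc b) * \<phi>) \<in> I (Suc (Suc b))"
      unfolding w' using I_add[OF I_mult[OF I_pow[of "Suc (Suc b)" "(- (1 + X * h)) ^ Suc (Suc b)"], of y] I_M[of w]]
      by (simp only: M distrib_left mult_ac)
    \<comment> \<open>As \<open>s \<le> \<phi>\<close>, this exponent contains the one of the
      induction hypothesis; the \<open>c\<close> in \<open>X ^ s = y - c X k\<close> raises the
      index of the ideal by one.\<close>
    have "Suc (Suc b) * \<phi> = (\<phi> - s) + (\<phi> + s + b * \<phi>)" using s by simp
    then have "X ^ (Suc (Suc b) * \<phi>) = X ^ (\<phi> - s) * X ^ (\<phi> + s + b * \<phi>)"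
      by (simp only: power_add[symmetric])
    then have "X ^ (Suc (Suc b) * \<phi>) \<in> I (Suc b)" using I_mult[OF Suc] by simp
    then have 2: "- (c * ((X * k) * X ^ (Suc (Suc b) * \<phi>))) \<in> I (Suc (Suc b))"
      by (intro I_uminus I_c I_mult)
    have "\<phi> + s + Suc b * \<phi> = s + Suc (Suc b) * \<phi>" by simp
    then have "X ^ (\<phi> + s + Suc b * \<phi>) = X ^ s * X ^ (Suc (Suc b) * \<phi>)"
      by (simp only: power_add)
    also have "\<dots> = y * X ^ (Suc (Suc b) * \<phi>) + - (c * ((X * k) * X ^ (Suc (Suc b) * \<phi>)))"
      unfolding Xs by (simp add: algebra_simps)
    finally show ?case using I_add[OF 1 2] by simp
  qed
  then show "\<exists>u. M dvd X ^ (\<phi> + s + b * \<phi>) - c ^ Suc b * u" by (simp add: I_def)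
  have Q: "X ^ (Suc b * \<phi>) \<in> I b" for b
  proof (cases b)
    case (Suc d)
    have "Suc b * \<phi> = (\<phi> - s) + (\<phi> + s + d * \<phi>)" using s Suc by simp
    then have "X ^ (Suc b * \<phi>) = X ^ (\<phi> - s) * X ^ (\<phi> + s + d * \<phi>)"
      by (simp only: power_add[symmetric])
    then show ?thesis using I_mult[OF P[of d]] Suc by simp
  qed (simp add: I_0)
  \<comment> \<open>In the induction step one \<open>X ^ \<phi>\<close> is replaced by
    \<open>\<Phi> - c - c X h\<close>. Of the three resulting terms the first is handled by fact
    \<open>3\<close>, the second by the induction hypothesis, and the third, whose exponent is one
    larger, by \<open>P\<close>.\<close>
  have "X ^ (\<phi> + s - 1 + b * \<phi>) + - ((- c) ^ b * X ^ (\<phi> + s - 1)) \<in> I (Suc b)" for b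
  proof (induction b)
    case 0
    show ?case using I_pow[of "Suc 0" 0] by simp
  next
    case (Suc b)
    let ?e = "\<phi> + s - 1 + b * \<phi>"
    have e: "Suc ?e = \<phi> + s + b * \<phi>" using s by simp
    have 1: "- (c * (h * X ^ Suc ?e)) \<in> I (Suc (Suc b))"
      unfolding e by (intro I_uminus I_c I_mult P)
    have 2: "- (c * (X ^ ?e + - ((- c) ^ b * X ^ (\<phi> + s - 1)))) \<in> I (Suc (Suc b))"
      by (intro I_uminus I_c Suc)
    \<comment> \<open>Splitting off \<open>X ^ s\<close> leaves an exponent one short of a multiple
      of \<open>\<phi>\<close>; the factor \<open>X\<close> in the error term \<open>c X k\<close>
      restores it.\<close>
    have e': "?e = s + (Suc b * \<phi> - 1)" using s by simp
    have pos: "Suc b * \<phi> = Suc (Suc b * \<phi> - 1)" using s by simp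
    have cQ: "c * X ^ (Suc b * \<phi>) \<in> I (Suc b)" by (intro I_c Q)
    have "X ^ \<phi> * X ^ (Suc b * \<phi>) = X ^ (Suc (Suc b) * \<phi>)" by (simp add: power_add)
    then have X2: "\<Phi> * X ^ (Suc b * \<phi>) = X ^ (Suc (Suc b) * \<phi>) + (1 + X * h) * (c * X ^ (Suc b * \<phi>))"
      unfolding Phi by (simp add: algebra_simps)
    have "\<Phi> * X ^ (Suc b * \<phi>) \<in> I (Suc b)"
      unfolding X2 by (intro I_add I_mult Q cQ)
    then have "- (c * (k * (\<Phi> * X ^ (Suc b * \<phi>)))) \<in> I (Suc (Suc b))"
      by (intro I_uminus I_c I_mult[of "\<Phi> * X ^ (Suc b * \<phi>)"])
    from I_add[OF this I_M[of "X ^ (Suc b * \<phi> - 1)"]]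
    have "- (c * (k * (\<Phi> * X ^ (Suc b * \<phi>)))) + M * X ^ (Suc b * \<phi> - 1) \<in> I (Suc (Suc b))" .
    also have "- (c * (k * (\<Phi> * X ^ (Suc b * \<phi>)))) + M * X ^ (Suc b * \<phi> - 1) = \<Phi> * X ^ ?e"
      unfolding e' power_add Xs M by (subst pos, unfold power_Suc) (simp add: algebra_simps)
    finally have 3: "\<Phi> * X ^ ?e \<in> I (Suc (Suc b))" .
    have "\<phi> + s - 1 + Suc b * \<phi> = \<phi> + ?e" by simp
    then have "X ^ (\<phi> + s - 1 + Suc b * \<phi>) = X ^ \<phi> * X ^ ?e" by (simp only: power_add)
    also have "\<dots> = \<Phi> * X ^ ?e - c * X ^ ?e - c * (h * X ^ Suc ?e)"
      unfolding X\<phi> by (simp add: algebra_simps)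
    finally have "X ^ (\<phi> + s - 1 + Suc b * \<phi>) + - ((- c) ^ Suc b * X ^ (\<phi> + s - 1)) =
        \<Phi> * X ^ ?e + (- (c * (X ^ ?e + - ((- c) ^ b * X ^ (\<phi> + s - 1)))) + - (c * (h * X ^ Suc ?e)))"
      by (simp add: algebra_simps)
    then show ?case using I_add[OF 3 I_add[OF 2 1]] by simp
  qed
  then show "\<exists>u. M dvd X ^ (\<phi> + s - 1 + b * \<phi>) - (- c) ^ b * X ^ (\<phi> + s - 1) - c ^ Suc b * u"
    by (simp add: I_def)
qed

section \<open>Integer polynomials acting by shifts\<close>

text \<open>The variable acts as the shift by \<open>g\<close>, so a polynomial acts as its value at
  \<open>g\<close> in the group ring, and polynomial identities become identities of maps.\<close>

definition act :: "'a::ab_group_add \<Rightarrow> int poly \<Rightarrow> ('a \<Rightarrow> 'b::ab_group_add) \<Rightarrow> 'a \<Rightarrow> 'b" where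
  "act g P f x = (\<Sum>j\<le>degree P. zsmul (coeff P j) (f (x + nsmul j g)))"

lemma act_eq_sum:
  assumes "degree P \<le> N"
  shows "act g P f x = (\<Sum>j\<le>N. zsmul (coeff P j) (f (x + nsmul j g)))"
  unfolding act_def using assms
  by (intro sum.mono_neutral_left) (auto simp: coeff_eq_0)

lemma act_0 [simp]: "act g 0 f = (\<lambda>x. 0)"
  by (simp add: act_def fun_eq_iff)

lemma act_pCons: "act g (pCons a P) f x = zsmul a (f x) + act g P f (x + g)"
proof -
  have "act g (pCons a P) f x = (\<Sum>j\<le>Suc (degree P). zsmul (coeff (pCons a P) j) (f (x + nsmul j g)))"
    by (rule act_eq_sum) (rule degree_pCons_le)
  also have "\<dots> = zsmul a (f x) + (\<Sum>j\<le>degree P. zsmul (coeff P j) (f (x + nsmul (Suc j) g)))"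
    by (subst sum.atMost_Suc_shift) simp
  finally show ?thesis by (simp add: act_def nsmul_Suc add.assoc)
qed

lemma act_add: "act g (P + Q) f x = act g P f x + act g Q f x"
proof -
  let ?N = "max (degree P) (degree Q)"
  have "degree (P + Q) \<le> ?N" by (rule degree_add_le_max)
  then show ?thesis
    by (simp add: act_eq_sum[of _ ?N] zsmul.scale_left_distrib sum.distrib)
qed

lemma act_smult: "act g (smult c P) f x = zsmul c (act g P f x)"
  by (simp add: act_eq_sum[OF degree_smult_le] act_def zsmul.scale_sum_right)

lemma act_diff: "act g (P - Q) f x = act g P f x - act g Q f x"
  using act_add[of g P "smult (-1) Q" f x] by (simp only: act_smult) simp

lemma act_mult: "act g (P * Q) f = act g P (act g Q f)"
proof (induction P)
  case (pCons a P)
  show ?case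
    by (rule ext) (simp add: act_add act_smult act_pCons pCons.IH)
qed simp

lemma act_one [simp]: "act g 1 f = f"
  by (simp add: one_pCons act_pCons fun_eq_iff)

lemma act_augmentation: "act g [:-1, 1:] f = diffop g f"
  by (simp add: act_pCons fun_eq_iff diffop_def)

lemma act_augmentation_power: "act g ([:-1, 1:] ^ n) f = diffs (replicate n g) f"
proof (induction n)
  case (Suc n)
  then show ?case
    by (simp only: power_Suc act_mult act_augmentation replicate_Suc diffs_Cons)
qed simp

lemma act_X_power: "act g ([:0, 1:] ^ n) f x = f (x + nsmul n g)"
proof (induction n arbitrary: x)
  case (Suc n)
  have "act g ([:0, 1:] * [:0, 1:] ^ n) f x = act g ([:0, 1:] ^ n) f (x + g)"
    by (simp only: act_mult) (simp add: act_pCons)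
  then show ?case by (simp add: Suc nsmul_Suc add.assoc)
qed simp

text \<open>For a subgroup \<open>K\<close>, these are the maps that factor through the quotient by
  \<open>K\<close>, expressed without a quotient type. The conditions range over the whole type, so
  they survive every shift.\<close>

definition invariant_maps :: "'a::ab_group_add set \<Rightarrow> 'b::ab_group_add set \<Rightarrow> ('a \<Rightarrow> 'b) set" where
  "invariant_maps K T = {f. range f \<subseteq> T \<and> (\<forall>x. \<forall>k\<in>K. f (x + k) = f x)}"

lemma act_invariant_maps:
  assumes "zsmul.subspace T" "f \<in> invariant_maps K T"
  shows "act g P f \<in> invariant_maps K T"
proof -
  have "f (x + k + nsmul j g) = f (x + nsmul j g)" if "k \<in> K" for x k j
  proof -
    have "f (x + nsmul j g + k) = f (x + nsmul j g)"
      using assms(2) that by (simp add: invariant_maps_def)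
    then show ?thesis by (simp add: add_ac)
  qed
  moreover have "act g P f x \<in> T" for x
    unfolding act_def using assms(2)
    by (intro zsmul.subspace_sum[OF assms(1)] zsmul.subspace_scale[OF assms(1)])
       (auto simp: invariant_maps_def)
  ultimately show ?thesis by (auto simp: invariant_maps_def act_def)
qed

lemma diffs_invariant_maps:
  assumes "zsmul.subspace T" "f \<in> invariant_maps K T"
  shows "diffs as f \<in> invariant_maps K T"
proof (induction as)
  case (Cons a as)
  then show ?case
    using act_invariant_maps[OF assms(1)] by (simp add: diffs_Cons act_augmentation[symmetric])
qed (simp add: assms)

lemma act_of_nat_power_mult:
  "act g (of_nat p ^ b * P) f x = zsmul (int p ^ b) (act g P f x)"
proof -
  have "(of_nat p :: int poly) ^ b * P = smult (int p ^ b) P"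
    by (induction b) (simp_all add: of_nat_poly mult.assoc)
  then show ?thesis by (simp add: act_smult)
qed

text \<open>For \<open>f \<in> invariant_maps K T\<close> and \<open>nsmul (p ^ a) g \<in> K\<close> the polynomial \<open>Y^(p^a) - 1\<close> acts on \<open>f\<close>
  as zero, so congruences modulo this polynomial become identities between differences.\<close>
lemma
  assumes p: "prime p" and a: "1 \<le> a" and T: "zsmul.subspace T"
    and f: "f \<in> invariant_maps K T" and g: "nsmul (p ^ a) g \<in> K"
  shows diffs_replicate_divisible: "\<exists>h\<in>invariant_maps K T.
      diffs (replicate (p ^ a + b * ((p - 1) * p ^ (a - 1))) g) f = (\<lambda>x. zsmul (int p ^ Suc b) (h x))"
    and diffs_replicate_reduce: "\<exists>h\<in>invariant_maps K T.
      diffs (replicate (p ^ a - 1 + b * ((p - 1) * p ^ (a - 1))) g) f =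
        (\<lambda>x. zsmul ((- int p) ^ b) (diffs (replicate (p ^ a - 1) g) f x) + zsmul (int p ^ Suc b) (h x))"
proof -
  \<comment> \<open>\<open>\<phi>\<close> is the degree of the cyclotomic factor, and
    \<open>\<phi> + s = p ^ a\<close> translates the abstract exponents into those of the
    claims.\<close>
  define s where "s = p ^ (a - 1)"
  define \<phi> where "\<phi> = s * (p - 1)"
  define X :: "int poly" where "X = [:-1, 1:]"
  define M :: "int poly" where "M = [:0, 1:] ^ (p * s) - 1"
  have p2: "2 \<le> p" using p by (rule prime_ge_2_nat)
  have s: "0 < s" "s \<le> \<phi>" using p2 by (auto simp: s_def \<phi>_def)
  have ps: "p * s = p ^ a" using a by (simp add: s_def power_eq_if)
  have q: "\<phi> + s = p ^ a" unfolding ps[symmetric] \<phi>_def using p2 by (cases p) auto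
  have act_M: "act g (M * V) f = (\<lambda>x. 0)" for V
  proof -
    have "act g V f \<in> invariant_maps K T" by (rule act_invariant_maps[OF T f])
    then have "act g M (act g V f) = (\<lambda>x. 0)"
      using g by (simp add: fun_eq_iff M_def act_diff act_X_power ps invariant_maps_def)
    then show ?thesis by (simp only: act_mult)
  qed
  obtain \<Phi> y h k where
    M: "M = \<Phi> * y" and Phi: "\<Phi> = X ^ \<phi> + of_nat p * (1 + X * h)" and y: "y = X ^ s + of_nat p * (X * k)"
    using cyclotomic_congruences[OF p, of "a - 1"] unfolding X_def M_def \<phi>_def s_def by metis
  note cong = augmentation_power_congruences[OF M Phi y s, of b]
  from cong(1) obtain U V where "X ^ (\<phi> + s + b * \<phi>) - of_nat p ^ Suc b * U = M * V"
    by (auto simp: dvd_def)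
  then have *: "X ^ (\<phi> + s + b * \<phi>) = M * V + of_nat p ^ Suc b * U" by (simp add: algebra_simps)
  have "diffs (replicate (\<phi> + s + b * \<phi>) g) f x = zsmul (int p ^ Suc b) (act g U f x)" for x
    using arg_cong[OF *, of "\<lambda>P. act g P f x"]
    by (simp only: act_add act_M act_of_nat_power_mult) (simp add: X_def act_augmentation_power)
  moreover have \<phi>: "\<phi> = (p - 1) * p ^ (a - 1)" by (simp add: \<phi>_def s_def)
  ultimately show "\<exists>h\<in>invariant_maps K T.
      diffs (replicate (p ^ a + b * ((p - 1) * p ^ (a - 1))) g) f = (\<lambda>x. zsmul (int p ^ Suc b) (h x))"
    unfolding q[symmetric] \<phi>[symmetric] using act_invariant_maps[OF T f] by blast
  from cong(2) obtain U V where "X ^ (\<phi> + s - 1 + b * \<phi>) - (- of_nat p) ^ b * X ^ (\<phi> + s - 1)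
      - of_nat p ^ Suc b * U = M * V" by (auto simp: dvd_def)
  then have *: "X ^ (\<phi> + s - 1 + b * \<phi>) =
      M * V + ((- of_nat p) ^ b * X ^ (\<phi> + s - 1) + of_nat p ^ Suc b * U)"
    by (simp add: algebra_simps)
  have "(- of_nat p :: int poly) ^ b = [: (- int p) ^ b :]"
    by (induction b) (simp_all add: of_nat_poly one_pCons)
  then have "(- of_nat p :: int poly) ^ b * X ^ (\<phi> + s - 1) = smult ((- int p) ^ b) (X ^ (\<phi> + s - 1))"
    by simp
  note ** = *[unfolded this]
  have "diffs (replicate (\<phi> + s - 1 + b * \<phi>) g) f x =
      zsmul ((- int p) ^ b) (diffs (replicate (\<phi> + s - 1) g) f x) + zsmul (int p ^ Suc b) (act g U f x)" for x
    using arg_cong[OF **, of "\<lambda>P. act g P f x"]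
    by (simp only: act_add act_M act_of_nat_power_mult act_smult) (simp add: X_def act_augmentation_power)
  then show "\<exists>h\<in>invariant_maps K T.
      diffs (replicate (p ^ a - 1 + b * ((p - 1) * p ^ (a - 1))) g) f =
        (\<lambda>x. zsmul ((- int p) ^ b) (diffs (replicate (p ^ a - 1) g) f x) + zsmul (int p ^ Suc b) (h x))"
    unfolding q[symmetric] \<phi>[symmetric] using act_invariant_maps[OF T f] by blast
qed

section \<open>Upper and lower bounds for the degree\<close>

text \<open>The first \<open>p ^ a\<close> differences gain one factor \<open>p\<close>, and every
  further block of \<open>(p - 1) * p ^ (a - 1)\<close> gains another; division with remainder
  counts the blocks.\<close>

lemma diffs_replicate_valuation:
  assumes p: "prime p" and a: "1 \<le> a" and T: "zsmul.subspace T"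
    and f: "f \<in> invariant_maps K T" and g: "nsmul (p ^ a) g \<in> K"
  shows "\<exists>b. e < p ^ a + b * ((p - 1) * p ^ (a - 1)) \<and>
    (\<exists>h\<in>invariant_maps K T. diffs (replicate e g) f = (\<lambda>x. zsmul (int p ^ b) (h x)))"
proof (cases "e < p ^ a")
  case True
  then show ?thesis
    by (intro exI[of _ 0]) (auto intro!: bexI[of _ "diffs (replicate e g) f"] diffs_invariant_maps[OF T f])
next
  case False
  let ?\<phi> = "(p - 1) * p ^ (a - 1)"
  define c where "c = (e - p ^ a) div ?\<phi>"
  define d where "d = (e - p ^ a) mod ?\<phi>"
  have pos: "0 < ?\<phi>" using prime_ge_2_nat[OF p] by simp
  have "e - p ^ a = c * ?\<phi> + d" by (simp only: c_def d_def div_mult_mod_eq)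
  then have e: "e = (p ^ a + c * ?\<phi>) + d" using False by linarith
  have "diffs (replicate d g) f \<in> invariant_maps K T" by (rule diffs_invariant_maps[OF T f])
  from diffs_replicate_divisible[OF p a T this g, of c] obtain h where "h \<in> invariant_maps K T"
    "diffs (replicate (p ^ a + c * ?\<phi>) g) (diffs (replicate d g) f) = (\<lambda>x. zsmul (int p ^ Suc c) (h x))"
    by blast
  moreover have "diffs (replicate e g) f = diffs (replicate (p ^ a + c * ?\<phi>) g) (diffs (replicate d g) f)"
    by (subst e) (simp only: replicate_add diffs_append)
  moreover have "d < ?\<phi>" using pos by (simp add: d_def)
  then have "e < p ^ a + Suc c * ?\<phi>" using e by simp
  ultimately show ?thesis by metis
qed

text \<open>Differences commute, so those along the last generator can be split off and their power
  of \<open>p\<close> multiplies the one gained from the others. \<open>p ^ a i - 1\<close>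
  differences per generator may gain nothing; \<open>\<phi>\<close> bounds all block
  lengths.\<close>

lemma diffs_generators_valuation:
  fixes r :: nat
  assumes p: "prime p" and T: "zsmul.subspace T" and f: "f \<in> invariant_maps K T"
    and a: "\<And>i. i < r \<Longrightarrow> 1 \<le> a i" and g: "\<And>i. i < r \<Longrightarrow> nsmul (p ^ a i) (g i) \<in> K"
    and \<phi>: "\<And>i. i < r \<Longrightarrow> (p - 1) * p ^ (a i - 1) \<le> \<phi>"
    and "set js \<subseteq> {..<r}"
  shows "\<exists>b. length js \<le> (\<Sum>i<r. p ^ a i - 1) + b * \<phi> \<and>
    (\<exists>h\<in>invariant_maps K T. diffs (map g js) f = (\<lambda>x. zsmul (int p ^ b) (h x)))"
  using a g \<phi> \<open>set js \<subseteq> {..<r}\<close>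
proof (induction r arbitrary: js)
  case 0
  then show ?case using f by (auto intro!: exI[of _ 0])
next
  case (Suc r)
  let ?ks = "filter (\<lambda>i. i \<noteq> r) js" and ?rs = "filter (\<lambda>i. i = r) js"
  have "set ?ks \<subseteq> {..<r}" using Suc.prems(4) by auto
  with Suc.IH[of ?ks] Suc.prems(1-3) obtain b h where
    b: "length ?ks \<le> (\<Sum>i<r. p ^ a i - 1) + b * \<phi>" and h: "h \<in> invariant_maps K T"
    and js: "diffs (map g ?ks) f = (\<lambda>x. zsmul (int p ^ b) (h x))" by auto
  obtain c h' where c: "length ?rs < p ^ a r + c * ((p - 1) * p ^ (a r - 1))"
    and h': "h' \<in> invariant_maps K T"
    and rs: "diffs (replicate (length ?rs) (g r)) h = (\<lambda>x. zsmul (int p ^ c) (h' x))"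
    using diffs_replicate_valuation[OF p Suc.prems(1)[of r] T h Suc.prems(2)[of r], of "length ?rs"] by auto
  have "map g ?rs = replicate (length ?rs) (g r)"
    by (rule replicate_eqI) auto
  moreover have "mset (map g js) = mset (map g ?rs @ map g ?ks)"
    by (simp only: mset_map mset_append mset_filter image_mset_union[symmetric] multiset_partition[symmetric])
  then have "diffs (map g js) f = diffs (map g ?rs) (diffs (map g ?ks) f)"
    by (simp only: diffs_append[symmetric]) (rule diffs_mset_cong)
  ultimately have "diffs (map g js) f = (\<lambda>x. zsmul (int p ^ (b + c)) (h' x))"
    by (simp add: js diffs_zsmul rs power_add)
  moreover have "length js = length ?rs + length ?ks"
    by (rule sum_length_filter_compl[symmetric])
  moreover have "c * ((p - 1) * p ^ (a r - 1)) \<le> c * \<phi>"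
    using Suc.prems(3)[of r] by (intro mult_le_mono2) simp
  moreover have "(\<Sum>i<Suc r. p ^ a i - 1) = (\<Sum>i<r. p ^ a i - 1) + (p ^ a r - 1)" by simp
  ultimately have "length js \<le> (\<Sum>i<Suc r. p ^ a i - 1) + (b + c) * \<phi>
      \<and> diffs (map g js) f = (\<lambda>x. zsmul (int p ^ (b + c)) (h' x))"
    using b c add_mult_distrib[of b c \<phi>] by linarith
  then show ?case using h' by blast
qed

text \<open>For \<open>K\<close> inside \<open>S\<close> this says that the quotient of
  \<open>S\<close> by \<open>K\<close> is the direct sum of the cyclic groups of orders
  \<open>p ^ (as ! i)\<close> generated by the classes of the \<open>g i\<close>.
  \<open>K = {0}\<close> serves the finite case, other \<open>K\<close> the elementary abelian
  quotients.\<close>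

definition quotient_decomp ::
  "'a::ab_group_add set \<Rightarrow> 'a set \<Rightarrow> nat \<Rightarrow> nat list \<Rightarrow> (nat \<Rightarrow> 'a) \<Rightarrow> bool" where
  "quotient_decomp S K p as g \<longleftrightarrow> zsmul.subspace S \<and> zsmul.subspace K \<and>
     (\<forall>i<length as. g i \<in> S \<and> nsmul (p ^ (as ! i)) (g i) \<in> K) \<and>
     S \<subseteq> zsmul.span (K \<union> g ` {..<length as}) \<and>
     (\<forall>c. (\<forall>i<length as. c i < p ^ (as ! i)) \<and> (\<Sum>i<length as. nsmul (c i) (g i)) \<in> K \<longrightarrow>
        (\<forall>i<length as. c i = 0))"

text \<open>The value of the explicit formula at one prime; for descending \<open>as\<close> the
  first exponent belongs to the longest block.\<close>

definition top_degree :: "nat \<Rightarrow> nat list \<Rightarrow> nat \<Rightarrow> nat" where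
  "top_degree p as \<beta> = (\<Sum>i<length as. p ^ (as ! i) - 1) + (\<beta> - 1) * (p - 1) * p ^ (hd as - 1)"

text \<open>It suffices to test generators as directions. One direction in \<open>K\<close> kills
  \<open>f\<close>; a list of \<open>g i\<close> longer than the bound gains
  \<open>p ^ \<beta>\<close>, which annihilates \<open>T\<close>.\<close>

lemma fdeg_le_top_degree:
  assumes D: "quotient_decomp S K p as g" and p: "prime p" and T: "zsmul.subspace T"
    and f: "f \<in> invariant_maps K T" and \<beta>: "1 \<le> \<beta>" "\<And>t. t \<in> T \<Longrightarrow> nsmul (p ^ \<beta>) t = 0"
    and as: "sorted_wrt (\<ge>) as" "\<forall>a\<in>set as. 1 \<le> a"
  shows "fdeg_le S f (top_degree p as \<beta>)"
proof -
  let ?\<phi> = "(p - 1) * p ^ (hd as - 1)" and ?G = "K \<union> g ` {..<length as}"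
  have \<phi>: "(p - 1) * p ^ (as ! i - 1) \<le> ?\<phi>" if "i < length as" for i
  proof -
    have "as ! i \<le> hd as"
      using that as(1) by (cases as; cases i) auto
    then show ?thesis using prime_gt_0_nat[OF p] by (intro mult_le_mono2 power_increasing) auto
  qed
  have gen: "diffs bs f = (\<lambda>x. 0)" if bs: "length bs = Suc (top_degree p as \<beta>)" "set bs \<subseteq> ?G" for bs
  proof (cases "set bs \<inter> K = {}")
    case False
    then obtain k where k: "k \<in> set bs" "k \<in> K" by auto
    then obtain us vs where "bs = us @ k # vs" by (meson split_list)
    moreover have "diffop k (diffs vs f) = (\<lambda>x. 0)"
      using diffs_invariant_maps[OF T f, of vs] k by (simp add: diffop_def invariant_maps_def)
    ultimately show ?thesis by (simp add: diffs_append diffs_Cons)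
  next
    case True
    then have "\<forall>x\<in>set bs. \<exists>i<length as. x = g i" using bs(2) by auto
    then obtain \<iota> where \<iota>: "\<And>x. x \<in> set bs \<Longrightarrow> \<iota> x < length as \<and> x = g (\<iota> x)" by metis
    define js where "js = map \<iota> bs"
    have js: "bs = map g js" "set js \<subseteq> {..<length as}"
      using \<iota> by (auto simp: js_def intro!: map_idI[symmetric])
    obtain b h where b: "length js \<le> (\<Sum>i<length as. p ^ (as ! i) - 1) + b * ?\<phi>"
      and h: "h \<in> invariant_maps K T" "diffs bs f = (\<lambda>x. zsmul (int p ^ b) (h x))"
      using diffs_generators_valuation[where g = g and a = "\<lambda>i. as ! i", OF p T f _ _ \<phi> js(2)] D as(2)
      unfolding js(1) quotient_decomp_def by auto
    have "length js = Suc ((\<Sum>i<length as. p ^ (as ! i) - 1) + (\<beta> - 1) * ?\<phi>)"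
      using bs(1) js(1) by (simp add: top_degree_def mult.assoc)
    then have "(\<beta> - 1) * ?\<phi> < b * ?\<phi>"
      using b by linarith
    then have "\<beta> - 1 < b" using mult_less_cancel2 by blast
    then have "\<beta> \<le> b" by simp
    then obtain d where "b = d + \<beta>" by (metis le_add_diff_inverse2)
    then have "zsmul (int p ^ b) t = 0" if "t \<in> T" for t
      using \<beta>(2)[OF that] by (simp add: power_add zsmul.scale_scale[symmetric] of_nat_power[symmetric] del: of_nat_power zsmul.scale_scale)
    then have "zsmul (int p ^ b) (h x) = 0" for x using h(1) by (auto simp: invariant_maps_def)
    then show ?thesis by (simp add: h(2))
  qed
  have "diffs bs f = (\<lambda>x. 0)" if "length bs = Suc (top_degree p as \<beta>)" "set bs \<subseteq> S" for bs
    using diffs_span_eq_0[of _ ?G f bs] gen that D unfolding quotient_decomp_def by blast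
  then show ?thesis by (auto simp: fdeg_le_def)
qed

section \<open>Lower bound: differences of an indicator function\<close>

text \<open>In the binomial expansion of \<open>m\<close> equal differences only the unshifted value
  survives.\<close>

lemma diffs_replicate_at_isolated:
  assumes "\<And>t. 1 \<le> t \<Longrightarrow> t \<le> m \<Longrightarrow> f (x + nsmul t g) = 0"
  shows "diffs (replicate m g) f x = zsmul ((- 1) ^ m) (f x)"
  using assms
proof (induction m arbitrary: x)
  case (Suc m)
  have "diffs (replicate m g) f (x + g) = zsmul ((- 1) ^ m) (f (x + g))"
  proof (rule Suc.IH)
    fix t assume "1 \<le> t" "t \<le> m"
    then show "f (x + g + nsmul t g) = 0"
      using Suc.prems[of "Suc t"] by (simp add: nsmul_Suc add.assoc)
  qed
  moreover have "f (x + g) = 0" using Suc.prems[of 1] by simp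
  moreover have "diffs (replicate m g) f x = zsmul ((- 1) ^ m) (f x)"
    using Suc.prems by (intro Suc.IH) auto
  ultimately show ?case by (simp add: diffs_Cons diffop_def)
qed simp

text \<open>Differences along \<open>g i\<close> through all its nonzero coefficients isolate the
  coefficient zero, so \<open>p ^ (as ! i) - 1\<close> of them remove \<open>g i\<close> from the
  condition, up to a sign collected in \<open>u\<close>. With all generators removed, the value at
  \<open>0\<close> is plus or minus \<open>b\<close>.\<close>

lemma diffs_indicator:
  assumes D: "quotient_decomp S K p as g" and p: "0 < p"
    and f: "f = (\<lambda>x. if x \<in> K then b else 0)"
    and ks: "distinct ks" "set ks \<subseteq> {..<length as}"
  shows "\<exists>u. \<bar>u\<bar> = 1 \<and> (\<forall>c. (\<forall>i<length as. c i < p ^ (as ! i)) \<longrightarrow>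
     diffs (concat (map (\<lambda>i. replicate (p ^ (as ! i) - 1) (g i)) ks)) f
       (\<Sum>i\<in>{..<length as} - set ks. nsmul (c i) (g i)) =
     (if \<forall>i\<in>{..<length as} - set ks. c i = 0 then zsmul u b else 0))"
  using ks
proof (induction ks)
  case Nil
  have K: "0 \<in> K" using D by (simp add: quotient_decomp_def zsmul.subspace_0)
  have "f (\<Sum>i<length as. nsmul (c i) (g i)) = (if \<forall>i<length as. c i = 0 then b else 0)"
    if "\<forall>i<length as. c i < p ^ (as ! i)" for c
  proof (cases "\<forall>i<length as. c i = 0")
    case False
    then have "(\<Sum>i<length as. nsmul (c i) (g i)) \<notin> K"
      using D that unfolding quotient_decomp_def by blast
    then have "f (\<Sum>i<length as. nsmul (c i) (g i)) = 0" by (simp add: f)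
    with False show ?thesis by (simp only: if_False)
  qed (simp add: f K)
  then show ?case by (intro exI[of _ 1]) auto
next
  case (Cons k ks)
  let ?I = "{..<length as}" and ?F = "diffs (concat (map (\<lambda>i. replicate (p ^ (as ! i) - 1) (g i)) ks)) f"
  let ?m = "p ^ (as ! k) - 1"
  have k: "k < length as" "k \<notin> set ks" using Cons.prems by auto
  from Cons obtain u where u: "\<bar>u\<bar> = 1" and F: "\<And>c. (\<forall>i<length as. c i < p ^ (as ! i)) \<Longrightarrow>
     ?F (\<Sum>i\<in>?I - set ks. nsmul (c i) (g i)) = (if \<forall>i\<in>?I - set ks. c i = 0 then zsmul u b else 0)"
    by auto
  have I: "?I - set ks = insert k (?I - set (k # ks))" using k by auto
  have "diffs (replicate ?m (g k)) ?F (\<Sum>i\<in>?I - set (k # ks). nsmul (c i) (g i)) =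
     (if \<forall>i\<in>?I - set (k # ks). c i = 0 then zsmul ((- 1) ^ ?m * u) b else 0)"
    if c: "\<forall>i<length as. c i < p ^ (as ! i)" for c
  proof -
    let ?x = "\<Sum>i\<in>?I - set (k # ks). nsmul (c i) (g i)"
    \<comment> \<open>The shifted points have coefficient \<open>t\<close> at \<open>k\<close>, so
      the induction hypothesis applies to \<open>c(k := t)\<close>, and only \<open>t = 0\<close>
      can give a nonzero value.\<close>
    have step: "?F (?x + nsmul t (g k)) =
        (if t = 0 \<and> (\<forall>i\<in>?I - set (k # ks). c i = 0) then zsmul u b else 0)" if t: "t \<le> ?m" for t
    proof -
      have "t < p ^ (as ! k)" using t p by (metis Suc_pred' le_imp_less_Suc zero_less_power)
      then have "\<forall>i<length as. (c(k := t)) i < p ^ (as ! i)" using c by auto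
      note F[OF this]
      also have "(\<Sum>i\<in>?I - set ks. nsmul ((c(k := t)) i) (g i)) = ?x + nsmul t (g k)"
        unfolding I by (subst sum.insert) (auto intro!: sum.cong simp: add.commute)
      also have "(\<forall>i\<in>?I - set ks. (c(k := t)) i = 0) \<longleftrightarrow> t = 0 \<and> (\<forall>i\<in>?I - set (k # ks). c i = 0)"
        unfolding I by auto
      finally show ?thesis .
    qed
    have "diffs (replicate ?m (g k)) ?F ?x = zsmul ((- 1) ^ ?m) (?F ?x)"
      by (rule diffs_replicate_at_isolated) (simp only: step, simp)
    also have "?F ?x = (if \<forall>i\<in>?I - set (k # ks). c i = 0 then zsmul u b else 0)"
      using step[of 0] by simp
    finally show ?thesis by simp
  qed
  moreover have "\<bar>(- 1) ^ ?m * u\<bar> = 1" using u by (simp add: abs_mult power_abs)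
  ultimately show ?case
    by (intro exI[of _ "(- 1) ^ ?m * u"]) (simp only: list.map concat.simps diffs_append, blast)
qed

lemma zsmul_abs_eq_1: "\<bar>u\<bar> = 1 \<Longrightarrow> zsmul u x = 0 \<longleftrightarrow> x = 0"
  by (auto simp: abs_if split: if_splits dest: minus_equation_iff[THEN iffD1])

text \<open>The witness is the indicator of \<open>K\<close> with value \<open>b\<close>. Besides
  the differences that isolate \<open>0\<close>, there are \<open>\<beta> - 1\<close> extra blocks
  along \<open>g 0\<close>, a generator of largest order; they multiply the value by
  \<open>(- p) ^ (\<beta> - 1)\<close> modulo \<open>p ^ \<beta>\<close>.\<close>

lemma delta0_ge_top_degree:
  assumes D: "quotient_decomp S K p as g" and p: "prime p"
    and as: "as \<noteq> []" "sorted_wrt (\<ge>) as" "\<forall>a\<in>set as. 1 \<le> a"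
    and \<beta>: "1 \<le> \<beta>" and b: "nsmul (p ^ \<beta>) b = 0" "nsmul (p ^ (\<beta> - 1)) b \<noteq> 0"
    and T: "0 \<in> T" "b \<in> T"
  shows "ereal (real (top_degree p as \<beta>)) \<le> delta0 S T"
proof -
  let ?f = "\<lambda>x. if x \<in> K then b else 0"
  let ?q = "p ^ (as ! 0)" and ?\<phi> = "(p - 1) * p ^ (as ! 0 - 1)"
  \<comment> \<open>\<open>T\<close> is only known to contain \<open>0\<close> and \<open>b\<close>,
    so the congruences are applied in the subgroup killed by \<open>p ^ \<beta>\<close>.\<close>
  define U where "U = {t :: 'b. nsmul (p ^ \<beta>) t = 0}"
  have U: "zsmul.subspace U"
    by (rule zsmul_subspaceI) (auto simp: U_def nsmul_distrib nsmul_minus)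
  have K: "zsmul.subspace K" and S: "zsmul.subspace S" using D by (auto simp: quotient_decomp_def)
  have f: "?f \<in> invariant_maps K U"
  proof -
    have "x + k \<in> K \<longleftrightarrow> x \<in> K" if "k \<in> K" for x k
      using zsmul.subspace_add[OF K] zsmul.subspace_diff[OF K, of "x + k" k] that by auto
    then show ?thesis using b by (auto simp: invariant_maps_def U_def)
  qed
  have "fdeg_le S ?f (top_degree p as \<beta>)"
    by (rule fdeg_le_top_degree[OF D p U f \<beta> _ as(2,3)]) (simp add: U_def)
  then have fin: "fdeg S ?f < \<infinity>"
    by (auto dest: fdeg_le_imp_fdeg intro: le_less_trans)
  have len: "0 < length as" using as by simp
  define L where "L ks = concat (map (\<lambda>i. replicate (p ^ (as ! i) - 1) (g i)) ks)" for ks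
  obtain u where u: "\<bar>u\<bar> = 1" and "\<forall>c. (\<forall>i<length as. c i < p ^ (as ! i)) \<longrightarrow>
      diffs (L [0..<length as]) ?f 0 = zsmul u b"
    using diffs_indicator[OF D prime_gt_0_nat[OF p] refl, of "[0..<length as]" b]
    by (auto simp: L_def lessThan_atLeast0)
  then have "diffs (L [0..<length as]) ?f 0 = zsmul u b"
    using prime_gt_0_nat[OF p] by (auto dest!: spec[of _ "\<lambda>i. 0"])
  moreover have L: "L [0..<length as] = replicate (?q - 1) (g 0) @ L [1..<length as]"
    using len by (simp add: L_def upt_conv_Cons)
  ultimately have Lf: "diffs (replicate (?q - 1) (g 0)) (diffs (L [1..<length as]) ?f) 0 = zsmul u b"
    by (simp add: diffs_append)
  define bs where "bs = replicate ((\<beta> - 1) * ?\<phi>) (g 0) @ L [0..<length as]"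
  have "bs = replicate (?q - 1 + (\<beta> - 1) * ?\<phi>) (g 0) @ L [1..<length as]"
    by (simp add: bs_def L replicate_add[symmetric] add.commute flip: append_assoc)
  then have bs: "diffs bs ?f = diffs (replicate (?q - 1 + (\<beta> - 1) * ?\<phi>) (g 0)) (diffs (L [1..<length as]) ?f)"
    by (simp only: diffs_append)
  have a0: "1 \<le> as ! 0" using as by simp
  have g0: "nsmul ?q (g 0) \<in> K" using D len by (simp add: quotient_decomp_def)
  obtain h where h: "h \<in> invariant_maps K U" and
    "diffs (replicate (?q - 1 + (\<beta> - 1) * ?\<phi>) (g 0)) (diffs (L [1..<length as]) ?f) =
      (\<lambda>x. zsmul ((- int p) ^ (\<beta> - 1)) (diffs (replicate (?q - 1) (g 0)) (diffs (L [1..<length as]) ?f) x) +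
        zsmul (int p ^ Suc (\<beta> - 1)) (h x))"
    using diffs_replicate_reduce[OF p a0 U diffs_invariant_maps[OF U f] g0] by blast
  then have h0: "diffs bs ?f 0 =
      zsmul ((- int p) ^ (\<beta> - 1)) (zsmul u b) + zsmul (int p ^ Suc (\<beta> - 1)) (h 0)"
    by (simp only: bs Lf)
  have "zsmul (int p ^ Suc (\<beta> - 1)) (h 0) = zsmul (int (p ^ \<beta>)) (h 0)"
    using \<beta> by simp
  also have "\<dots> = 0" using h by (auto simp: invariant_maps_def U_def simp del: of_nat_power)
  finally have "diffs bs ?f 0 = zsmul ((- 1) ^ (\<beta> - 1) * u) (zsmul (int (p ^ (\<beta> - 1))) b)"
    using h0 by (simp add: power_minus[of "int p"] mult_ac)
  then have nz: "diffs bs ?f 0 \<noteq> 0"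
    using b(2) u by (simp add: zsmul_abs_eq_1 abs_mult power_abs del: of_nat_power zsmul.scale_scale)
  have "set bs \<subseteq> S" using D len by (auto simp: bs_def L_def quotient_decomp_def split: if_splits)
  from fdeg_geI[OF S this zsmul.subspace_0[OF S] nz]
  have "ereal (real (length bs)) \<le> fdeg S ?f" .
  also have "\<dots> \<le> delta0 S T" using T fin by (intro delta0_ge) auto
  also have "length bs = top_degree p as \<beta>"
    using as(1) by (simp add: bs_def L_def top_degree_def length_concat hd_conv_nth mult.assoc
        comp_def interv_sum_list_conv_sum_set_nat atLeast0LessThan)
  finally show ?thesis .
qed

section \<open>Primary components\<close>

lemma subspace_ppart: "zsmul.subspace (ppart p)"
proof (rule zsmul_subspaceI)
  show "0 \<in> ppart p" by (auto simp: ppart_def)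
  show "- x \<in> ppart p" if "x \<in> ppart p" for x :: 'a
    using that by (auto simp: ppart_def nsmul_minus)
  show "x + y \<in> ppart p" if "x \<in> ppart p" "y \<in> ppart p" for x y :: 'a
  proof -
    from that obtain k l where k: "1 \<le> k" "nsmul (p ^ k) x = 0" and l: "1 \<le> l" "nsmul (p ^ l) y = 0"
      by (auto simp: ppart_def)
    have "nsmul (p ^ (k + l)) x = nsmul (p ^ l) (nsmul (p ^ k) x)"
      "nsmul (p ^ (k + l)) y = nsmul (p ^ k) (nsmul (p ^ l) y)"
      by (simp_all add: nsmul_mult[symmetric] power_add mult.commute)
    then have "nsmul (p ^ (k + l)) (x + y) = 0" using k l by (simp add: nsmul_distrib)
    then show ?thesis using k by (auto simp: ppart_def intro!: exI[of _ "k + l"])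
  qed
qed

text \<open>For prime \<open>p\<close> this is the complement of \<open>ppart p\<close> in a torsion
  group.\<close>

definition coprime_part :: "nat \<Rightarrow> 'a::ab_group_add set" where
  "coprime_part p = {x. \<exists>m. coprime m p \<and> nsmul m x = 0}"

lemma subspace_coprime_part: "zsmul.subspace (coprime_part p)"
proof (rule zsmul_subspaceI)
  show "0 \<in> coprime_part p" by (auto simp: coprime_part_def intro!: exI[of _ 1])
  show "- x \<in> coprime_part p" if "x \<in> coprime_part p" for x :: 'a
    using that by (auto simp: coprime_part_def nsmul_minus)
  show "x + y \<in> coprime_part p" if "x \<in> coprime_part p" "y \<in> coprime_part p" for x y :: 'a
  proof -
    from that obtain k l where k: "coprime k p" "nsmul k x = 0" and l: "coprime l p" "nsmul l y = 0"
      by (auto simp: coprime_part_def)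
    have "nsmul (k * l) x = nsmul l (nsmul k x)" "nsmul (k * l) y = nsmul k (nsmul l y)"
      by (simp_all add: nsmul_mult[symmetric] mult.commute)
    then have "nsmul (k * l) (x + y) = 0" using k l by (simp add: nsmul_distrib)
    then show ?thesis using k l by (auto simp: coprime_part_def intro!: exI[of _ "k * l"])
  qed
qed

lemma ppart_nsmul_eq_0:
  "x \<in> ppart p \<Longrightarrow> coprime m p \<Longrightarrow> nsmul m x = 0 \<Longrightarrow> x = 0"
  by (auto simp: ppart_def intro: coprime_nsmul_eq_0[of m "p ^ k" x for k])

lemma prime_power_decompose:
  assumes p: "prime p" and n: "1 \<le> (n::nat)"
  obtains k m where "n = p ^ k * m" "coprime m p"
proof -
  have "n \<noteq> 0" "\<not> is_unit p" using n p by (auto dest: not_prime_unit)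
  then obtain m where m: "n = p ^ multiplicity p n * m" "\<not> p dvd m"
    by (rule multiplicity_decompose')
  have "coprime m p" using prime_imp_coprime[OF p m(2)] by (simp only: coprime_commute)
  with m(1) show thesis by (rule that)
qed

text \<open>A Bezout identity between the two coprime factors of an annihilator of \<open>x\<close>
  splits \<open>x\<close>; uniqueness holds because the two parts meet only in zero.\<close>

lemma torsion_decomp:
  fixes x :: "'a::ab_group_add"
  assumes tor: "torsion_group TYPE('a)" and p: "prime p"
  shows "\<exists>!y. y \<in> ppart p \<and> x - y \<in> coprime_part p"
proof (rule ex_ex1I)
  obtain n where n: "1 \<le> n" "nsmul n x = 0" using tor by (auto simp: torsion_group_def)
  obtain k m where m: "n = p ^ k * m" and cop: "coprime m p"
    using prime_power_decompose[OF p n(1)] .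
  \<comment> \<open>\<open>Suc k\<close> replaces \<open>k\<close>, which may be zero, because
    \<open>ppart\<close> demands a positive exponent.\<close>
  from cop have "coprime m (p ^ Suc k)" by simp
  then obtain u v where uv: "u * int m + v * int (p ^ Suc k) = 1"
    by (rule coprime_int_combination)
  let ?y = "zsmul (u * int m) x" and ?z = "zsmul (v * int (p ^ Suc k)) x"
  have "nsmul (p ^ Suc k) ?y = zsmul (int (p ^ Suc k) * (u * int m)) x"
    by (simp only: zsmul_of_nat[symmetric] zsmul.scale_scale)
  also have "\<dots> = 0" by (rule zsmul_eq_0_dvd[OF n(2)]) (simp add: m)
  finally have y: "?y \<in> ppart p" unfolding ppart_def by (intro CollectI exI[of _ "Suc k"]) simp
  have "nsmul m ?z = zsmul (int m * (v * int (p ^ Suc k))) x"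
    by (simp only: zsmul_of_nat[symmetric] zsmul.scale_scale)
  also have "\<dots> = 0" by (rule zsmul_eq_0_dvd[OF n(2)]) (simp add: m)
  finally have z: "?z \<in> coprime_part p" using cop by (auto simp: coprime_part_def)
  have "x = zsmul (u * int m + v * int (p ^ Suc k)) x" by (simp only: uv zsmul.scale_one)
  then have "x - ?y = ?z" by (simp only: zsmul.scale_left_distrib) (metis add_diff_cancel_left')
  then show "\<exists>y. y \<in> ppart p \<and> x - y \<in> coprime_part p" using y z by metis
next
  fix y z assume "y \<in> ppart p \<and> x - y \<in> coprime_part p" "z \<in> ppart p \<and> x - z \<in> coprime_part p"
  then have "y - z \<in> ppart p" "(x - z) - (x - y) \<in> coprime_part p"
    by (blast intro: zsmul.subspace_diff subspace_ppart subspace_coprime_part)+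
  then obtain m where "y - z \<in> ppart p" "coprime m p" "nsmul m (y - z) = 0"
    by (auto simp: coprime_part_def)
  then have "y - z = 0" by (rule ppart_nsmul_eq_0)
  then show "y = z" by simp
qed

definition pcomp :: "nat \<Rightarrow> 'a::ab_group_add \<Rightarrow> 'a" where
  "pcomp p x = (THE y. y \<in> ppart p \<and> x - y \<in> coprime_part p)"

context
  fixes p :: nat and tag :: "'a::ab_group_add itself"
  assumes tor: "torsion_group TYPE('a)" and p: "prime p"
begin

lemma pcomp_in: "pcomp p (x::'a) \<in> ppart p" and pcomp_diff_in: "x - pcomp p x \<in> coprime_part p"
  using theI'[OF torsion_decomp[OF tor p, of x]] by (auto simp: pcomp_def)

lemma pcomp_eqI: "y \<in> ppart p \<Longrightarrow> (x::'a) - y \<in> coprime_part p \<Longrightarrow> pcomp p x = y"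
  using torsion_decomp[OF tor p, of x] pcomp_in[of x] pcomp_diff_in[of x] by blast

lemma pcomp_add: "pcomp p (x + y :: 'a) = pcomp p x + pcomp p y"
proof (rule pcomp_eqI)
  show "pcomp p x + pcomp p y \<in> ppart p"
    by (intro zsmul.subspace_add[OF subspace_ppart] pcomp_in)
  have "(x - pcomp p x) + (y - pcomp p y) \<in> coprime_part p"
    by (intro zsmul.subspace_add[OF subspace_coprime_part] pcomp_diff_in)
  then show "x + y - (pcomp p x + pcomp p y) \<in> coprime_part p" by (simp add: algebra_simps)
qed

lemma pcomp_diff: "pcomp p (x - y :: 'a) = pcomp p x - pcomp p y"
  using pcomp_add[of "x - y" y] by (simp add: algebra_simps)

lemma pcomp_ppart: "x \<in> ppart p \<Longrightarrow> pcomp p (x::'a) = x"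
  by (rule pcomp_eqI) (auto simp: zsmul.subspace_0[OF subspace_coprime_part])

end

text \<open>If a prime \<open>p\<close> divided the least \<open>n\<close> killing \<open>x\<close>,
  some multiplier prime to \<open>p\<close> would kill \<open>x\<close> as well, and hence so would
  \<open>n\<close> divided by \<open>p\<close>.\<close>

lemma pcomp_all_0:
  fixes x :: "'a::ab_group_add"
  assumes tor: "torsion_group TYPE('a)" and 0: "\<And>p. prime p \<Longrightarrow> pcomp p x = 0"
  shows "x = 0"
proof -
  let ?P = "\<lambda>n. 1 \<le> n \<and> nsmul n x = 0"
  define n where "n = (LEAST n. ?P n)"
  have ex: "\<exists>n. ?P n" using tor by (auto simp: torsion_group_def)
  have n: "1 \<le> n" "nsmul n x = 0" using LeastI_ex[OF ex] by (auto simp: n_def)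
  have "n = 1"
  proof (rule ccontr)
    assume "n \<noteq> 1"
    then obtain p where p: "prime p" "p dvd n" by (metis prime_factor_nat)
    obtain m where m: "coprime m p" "nsmul m x = 0"
      using pcomp_diff_in[OF tor p(1), of x] 0[OF p(1)] by (auto simp: coprime_part_def)
    obtain d where d: "n = p * d" using p by (auto simp: dvd_def)
    have "nsmul d x = 0"
    proof (rule coprime_nsmul_eq_0[OF m(1)])
      show "nsmul m (nsmul d x) = 0"
        by (simp add: nsmul_mult[symmetric] mult.commute[of m] ) (simp add: nsmul_mult m)
      show "nsmul p (nsmul d x) = 0" using n by (simp add: nsmul_mult[symmetric] d)
    qed
    moreover have "1 \<le> d" using n d by (cases d) auto
    ultimately have "n \<le> d" unfolding n_def by (intro Least_le) simp
    then show False using d n prime_ge_2_nat[OF p(1)] by auto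
  qed
  then show ?thesis using n by simp
qed

text \<open>By induction on the degree \<open>\<Delta>\<^bsub>a\<^esub> f\<close> is a constant \<open>c\<close>, whence \<open>f (x + j a) = f x + j c\<close> and \<open>m c = 0\<close>.\<close>
lemma diffop_eq_0_if_fdeg_le:
  fixes f :: "'a::ab_group_add \<Rightarrow> 'b::ab_group_add"
  assumes T: "zsmul.subspace T" and inj: "\<And>t. t \<in> T \<Longrightarrow> nsmul m t = 0 \<Longrightarrow> t = 0"
    and a: "nsmul m a = 0" and f: "range f \<subseteq> T" "fdeg_le UNIV f n"
  shows "diffop a f = (\<lambda>x. 0)"
  using f
proof (induction n arbitrary: f)
  case 0
  then show ?case by (auto simp: fdeg_le_def diffs_Cons dest: spec[of _ "[a]"])
next
  case (Suc n)
  have const: "diffop a f y = diffop a f 0" for y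
  proof -
    have "diffop a (diffop y f) = (\<lambda>x. 0)"
    proof (rule Suc.IH)
      show "range (diffop y f) \<subseteq> T"
        using Suc.prems(1) by (auto simp: diffop_def intro!: zsmul.subspace_diff[OF T])
      show "fdeg_le UNIV (diffop y f) n"
        unfolding fdeg_le_def
      proof (intro allI impI ballI)
        fix as :: "'a list" and x assume "length as = Suc n \<and> set as \<subseteq> UNIV"
        then show "diffs as (diffop y f) x = 0"
          using Suc.prems(2) by (auto simp: fdeg_le_def diffs_append diffs_Cons dest!: spec[of _ "as @ [y]"])
      qed
    qed
    then have "diffop y (diffop a f) 0 = 0" by (simp add: diffop_commute)
    then show ?thesis by (simp add: diffop_def)
  qed
  define c where "c = diffop a f 0"
  have "f (nsmul j a) = f 0 + nsmul j c" for j
  proof (induction j)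
    case (Suc j)
    have "f (nsmul j a + a) = f (nsmul j a) + c"
      using const[of "nsmul j a"] unfolding c_def[symmetric] by (simp add: diffop_def algebra_simps)
    then show ?case using Suc by (simp add: nsmul_Suc add_ac)
  qed simp
  from this[of m] have "nsmul m c = 0" using a by simp
  moreover have "c \<in> T"
    using Suc.prems(1) by (auto simp: c_def diffop_def intro!: zsmul.subspace_diff[OF T])
  ultimately have "c = 0" using inj by blast
  then show ?case using const by (simp add: c_def fun_eq_iff)
qed

section \<open>Reduction of the maximal degree to primary components\<close>

text \<open>Composition with \<open>pcomp p\<close>, a homomorphism that is the identity on
  \<open>ppart p\<close>, extends a map to the whole group without changing its degree.\<close>

lemma delta0_ppart_le:
  assumes tor: "torsion_group TYPE('a::ab_group_add)" and p: "prime p"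
  shows "delta0 (ppart p :: 'a set) (ppart p :: 'b::ab_group_add set) \<le> delta0 (UNIV :: 'a set) (UNIV :: 'b set)"
proof (rule delta0_leI)
  fix f :: "'a \<Rightarrow> 'b"
  assume f: "f ` ppart p \<subseteq> ppart p" and fin: "fdeg (ppart p) f < \<infinity>"
  let ?F = "\<lambda>x. f (pcomp p x)"
  have d: "diffs as ?F = (\<lambda>x. diffs (map (pcomp p) as) f (pcomp p x))" for as
    by (rule diffs_hom_right) (rule pcomp_add[OF tor p])
  have "fdeg_le UNIV ?F = fdeg_le (ppart p) f"
  proof (intro ext iffI)
    fix n
    assume F: "fdeg_le UNIV ?F n"
    show "fdeg_le (ppart p) f n"
      unfolding fdeg_le_def
    proof (intro allI impI ballI)
      fix as :: "'a list" and x :: 'a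
      assume as: "length as = Suc n \<and> set as \<subseteq> ppart p" "x \<in> ppart p"
      then have "map (pcomp p) as = as" by (auto intro!: map_idI pcomp_ppart[OF tor p])
      then have "diffs as f x = diffs as ?F x"
        using as by (simp add: d pcomp_ppart[OF tor p])
      also have "\<dots> = 0" using F as by (simp add: fdeg_le_def)
      finally show "diffs as f x = 0" .
    qed
  next
    fix n
    assume f: "fdeg_le (ppart p) f n"
    show "fdeg_le UNIV ?F n"
      unfolding fdeg_le_def
    proof (intro allI impI ballI)
      fix as :: "'a list" and x :: 'a
      assume "length as = Suc n \<and> set as \<subseteq> UNIV"
      with f show "diffs as ?F x = 0"
        unfolding d fdeg_le_def by (auto simp: pcomp_in[OF tor p] image_subset_iff)
    qed
  qed
  moreover have "(\<forall>x. ?F x = 0) \<longleftrightarrow> (\<forall>x\<in>ppart p. f x = 0)"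
    using pcomp_in[OF tor p] pcomp_ppart[OF tor p] by metis
  ultimately have eq: "fdeg (ppart p) f = fdeg UNIV ?F" unfolding fdeg_def by simp
  show "fdeg (ppart p) f \<le> delta0 (UNIV :: 'a set) (UNIV :: 'b set)"
    using fin unfolding eq by (intro delta0_ge) auto
qed

lemma delta0_ge_0:
  assumes "b \<in> T" "b \<noteq> 0" "0 \<in> S"
  shows "0 \<le> delta0 S T"
proof -
  have "fdeg_le S (\<lambda>x. b) 0"
    by (auto simp: fdeg_le_def length_Suc_conv diffs_Cons diffop_def)
  then have "(LEAST n. fdeg_le S (\<lambda>x. b) n) = 0" by (rule Least_eq_0)
  then have "fdeg S (\<lambda>x. b) = 0"
    using assms \<open>fdeg_le S (\<lambda>x. b) 0\<close> by (auto simp: fdeg_def zero_ereal_def)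
  then show ?thesis using delta0_ge[of "\<lambda>x. b" S T] assms by auto
qed

text \<open>For the upper estimate, a nonzero difference of full length has a nonzero component at
  some prime \<open>q\<close>. The \<open>q\<close>-component of \<open>f\<close> factors through
  \<open>pcomp q\<close>, so its restriction to \<open>ppart q\<close> has an equally long nonzero
  difference.\<close>

lemma delta0_eq_SUP_ppart:
  assumes ntB: "(UNIV :: 'b set) \<noteq> {0}"
    and torA: "torsion_group TYPE('a::ab_group_add)" and torB: "torsion_group TYPE('b::ab_group_add)"
  shows "delta0 (UNIV :: 'a set) (UNIV :: 'b set)
      = (SUP p\<in>{p::nat. prime p}. delta0 (ppart p :: 'a set) (ppart p :: 'b set))" (is "?D = ?S")
proof (rule antisym)
  show "?S \<le> ?D" by (rule SUP_least) (simp add: delta0_ppart_le[OF torA])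
  \<comment> \<open>This covers the maps of degree \<open>-\<infinity>\<close> and
    \<open>0\<close>.\<close>
  have S0: "0 \<le> ?S"
  proof -
    obtain b :: 'b where "b \<noteq> 0" using ntB by auto
    then obtain p where p: "prime p" "pcomp p b \<noteq> 0" using pcomp_all_0[OF torB] by blast
    then have "0 \<le> delta0 (ppart p :: 'a set) (ppart p :: 'b set)"
      by (intro delta0_ge_0[of "pcomp p b"]) (auto simp: pcomp_in[OF torB] zsmul.subspace_0[OF subspace_ppart])
    also have "\<dots> \<le> ?S" using p by (intro SUP_upper) auto
    finally show ?thesis .
  qed
  show "?D \<le> ?S"
  proof (rule delta0_leI)
    fix f :: "'a \<Rightarrow> 'b" assume fin: "fdeg UNIV f < \<infinity>"
    show "fdeg UNIV f \<le> ?S"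
    proof (cases "(\<forall>x. f x = 0) \<or> fdeg UNIV f = 0")
      case True
      moreover have "fdeg UNIV f = -\<infinity>" if "\<forall>x. f x = 0" using that by (simp add: fdeg_def)
      ultimately have "fdeg UNIV f \<le> 0" by auto
      then show ?thesis using S0 by (rule order_trans)
    next
      case False
      then have ex: "\<exists>n. fdeg_le UNIV f n" using fin by (auto simp: fdeg_def split: if_splits)
      define m where "m = (LEAST n. fdeg_le UNIV f n)"
      have fm: "fdeg UNIV f = ereal (real m)" "fdeg_le UNIV f m"
        using False ex LeastI_ex[OF ex] by (auto simp: fdeg_def m_def)
      then obtain l where l: "m = Suc l" using False by (cases m) auto
      \<comment> \<open>Minimality of the degree \<open>Suc l\<close> provides a nonzero difference
        of length exactly \<open>m\<close>.\<close>
      have "\<not> fdeg_le UNIV f l"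
        using not_less_Least[of l "\<lambda>n. fdeg_le UNIV f n"] l by (simp add: m_def)
      then obtain as x where as: "length as = m" "diffs as f x \<noteq> 0"
        by (auto simp: fdeg_le_def l)
      then obtain q where q: "prime q" "pcomp q (diffs as f x) \<noteq> 0"
        using pcomp_all_0[OF torB] by blast
      define h where "h = (\<lambda>x. pcomp q (f x))"
      have dh: "diffs bs h = (\<lambda>x. pcomp q (diffs bs f x))" for bs
        unfolding h_def by (rule diffs_hom_left) (rule pcomp_diff[OF torB q(1)])
      have h0: "pcomp q 0 = (0::'b)"
        by (rule pcomp_ppart[OF torB q(1)]) (rule zsmul.subspace_0[OF subspace_ppart])
      have hm: "fdeg_le UNIV h m" using fm(2) by (simp add: fdeg_le_def dh h0)
      have hr: "range h \<subseteq> ppart q" by (auto simp: h_def pcomp_in[OF torB q(1)])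
      have hq: "h = (\<lambda>x. h (pcomp q x))"
      proof
        fix x :: 'a
        obtain k where k: "coprime k q" "nsmul k (x - pcomp q x) = 0"
          using pcomp_diff_in[OF torA q(1), of x] by (auto simp: coprime_part_def)
        \<comment> \<open>A point and its \<open>q\<close>-component differ by an element of order
          prime to \<open>q\<close>, along which \<open>h\<close> is constant.\<close>
        have "diffop (x - pcomp q x) h = (\<lambda>x. 0)"
          by (rule diffop_eq_0_if_fdeg_le[OF subspace_ppart _ k(2) hr hm])
             (rule ppart_nsmul_eq_0[OF _ k(1)])
        then have "diffop (x - pcomp q x) h (pcomp q x) = 0" by simp
        then show "h x = h (pcomp q x)" by (simp add: diffop_def)
      qed
      have "diffs as (\<lambda>x. h (pcomp q x)) = (\<lambda>x. diffs (map (pcomp q) as) h (pcomp q x))"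
        by (rule diffs_hom_right) (rule pcomp_add[OF torA q(1)])
      then have "diffs (map (pcomp q) as) h (pcomp q x) = pcomp q (diffs as f x)"
        using dh[of as] hq by metis
      then have "ereal (real (length (map (pcomp q) as))) \<le> fdeg (ppart q) h"
        using q by (intro fdeg_geI[OF subspace_ppart, of _ _ "pcomp q x"])
          (auto simp: pcomp_in[OF torA q(1)])
      then have "fdeg UNIV f \<le> fdeg (ppart q) h" by (simp add: fm as)
      also have "fdeg_le (ppart q) h m" using hm by (simp add: fdeg_le_def)
      then have "fdeg (ppart q) h < \<infinity>" by (auto dest: fdeg_le_imp_fdeg intro: le_less_trans)
      then have "fdeg (ppart q) h \<le> delta0 (ppart q :: 'a set) (ppart q :: 'b set)"
        using hr by (intro delta0_ge) auto
      also have "\<dots> \<le> ?S" using q by (intro SUP_upper) auto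
      finally show ?thesis .
    qed
  qed
qed

section \<open>Elementary abelian quotients of groups of bounded exponent\<close>

text \<open>Modulo \<open>H\<close>, \<open>N\<close> is a vector space over the field with
  \<open>p\<close> elements; Zorn's lemma yields a hyperplane \<open>M\<close> that avoids
  \<open>x\<close>.\<close>

lemma maximal_subgroup_avoiding:
  assumes H: "zsmul.subspace H" "H \<subseteq> N" and N: "zsmul.subspace N"
    and p: "prime p" "\<And>y. y \<in> N \<Longrightarrow> nsmul p y \<in> H"
    and x: "x \<in> N" "x \<notin> H"
  obtains M where "zsmul.subspace M" "H \<subseteq> M" "M \<subseteq> N" "x \<notin> M" "N \<subseteq> zsmul.span (insert x M)"
proof -
  define \<M> where "\<M> = {M. zsmul.subspace M \<and> H \<subseteq> M \<and> M \<subseteq> N \<and> x \<notin> M}"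
  have HM: "H \<in> \<M>" using H x by (simp add: \<M>_def)
  have "\<exists>M\<in>\<M>. \<forall>X\<in>\<M>. M \<subseteq> X \<longrightarrow> X = M"
  proof (rule subset_Zorn_nonempty)
    show "\<M> \<noteq> {}" using HM by auto
    fix \<C> assume ne: "\<C> \<noteq> {}" and ch: "subset.chain \<M> \<C>"
    have C: "\<C> \<subseteq> \<M>" "\<And>X Y. X \<in> \<C> \<Longrightarrow> Y \<in> \<C> \<Longrightarrow> X \<subseteq> Y \<or> Y \<subseteq> X"
      using ch by (auto simp: subset.chain_def subset_chain_def)
    have sub: "zsmul.subspace X" if "X \<in> \<C>" for X using C(1) that by (auto simp: \<M>_def)
    have "zsmul.subspace (\<Union>\<C>)"
    proof (rule zsmul_subspaceI)
      show "0 \<in> \<Union>\<C>" using ne sub zsmul.subspace_0 by blast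
      show "- u \<in> \<Union>\<C>" if "u \<in> \<Union>\<C>" for u using that sub zsmul.subspace_neg by blast
      show "u + v \<in> \<Union>\<C>" if uv: "u \<in> \<Union>\<C>" "v \<in> \<Union>\<C>" for u v
      proof -
        obtain X Y where "X \<in> \<C>" "u \<in> X" "Y \<in> \<C>" "v \<in> Y" using uv by auto
        then obtain Z where "Z \<in> \<C>" "u \<in> Z" "v \<in> Z" using C(2)[of X Y] by blast
        then show ?thesis using zsmul.subspace_add[OF sub] by blast
      qed
    qed
    moreover have "H \<subseteq> \<Union>\<C>" using ne C(1) by (auto simp: \<M>_def)
    ultimately show "\<Union>\<C> \<in> \<M>" using C(1) by (auto simp: \<M>_def)
  qed
  then obtain M where M: "M \<in> \<M>" and max: "\<And>X. X \<in> \<M> \<Longrightarrow> M \<subseteq> X \<Longrightarrow> X = M" by blast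
  have Ms: "zsmul.subspace M" "H \<subseteq> M" "M \<subseteq> N" "x \<notin> M" using M by (auto simp: \<M>_def)
  have "y \<in> zsmul.span (insert x M)" if y: "y \<in> N" for y
  proof (cases "y \<in> M")
    case True
    then show ?thesis by (intro zsmul.span_base) simp
  next
    case False
    \<comment> \<open>By maximality, adjoining \<open>y\<close> must capture \<open>x\<close>. The
      coefficient of \<open>y\<close> is then invertible modulo \<open>p\<close>, so
      \<open>y\<close> is recovered from \<open>x\<close> and \<open>M\<close>.\<close>
    have "zsmul.span (insert y M) \<notin> \<M>"
    proof
      assume "zsmul.span (insert y M) \<in> \<M>"
      from max[OF this] have "zsmul.span (insert y M) = M" using zsmul.span_superset[of "insert y M"] by auto
      with False show False using zsmul.span_base[of y "insert y M"] by auto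
    qed
    moreover have "zsmul.span (insert y M) \<subseteq> N"
      by (rule zsmul.span_minimal) (use y Ms N in auto)
    moreover have "H \<subseteq> zsmul.span (insert y M)" using Ms zsmul.span_superset[of "insert y M"] by auto
    ultimately have "x \<in> zsmul.span (insert y M)" by (simp add: \<M>_def)
    then obtain k where "x - zsmul k y \<in> zsmul.span M" using zsmul.span_breakdown_eq by blast
    then have k: "x - zsmul k y \<in> M" using Ms by (simp add: zsmul.span_eq_iff[THEN iffD2])
    have py: "nsmul p y \<in> M" using p(2)[OF y] Ms by auto
    have "\<not> int p dvd k"
    proof
      assume "int p dvd k"
      then obtain c where "k = c * int p" by (metis dvdE mult.commute)
      then have "zsmul k y = zsmul c (nsmul p y)" by (simp add: zsmul.scale_scale[symmetric] del: zsmul.scale_scale)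
      then have "zsmul k y \<in> M" using py Ms zsmul.subspace_scale by metis
      with zsmul.subspace_add[OF Ms(1) k] have "x - zsmul k y + zsmul k y \<in> M" by blast
      with Ms(4) show False by simp
    qed
    then have "coprime (int p) k" using p by (intro prime_imp_coprime) auto
    then have "gcd k (int p) = 1" by (simp add: coprime_commute flip: coprime_iff_gcd_eq_1)
    then obtain u v where uv: "u * k + v * int p = 1"
      using bezout_int[of k "int p"] by auto
    have "y = zsmul (u * k + v * int p) y" by (simp add: uv)
    also have "\<dots> = zsmul u (zsmul k y) + zsmul v (nsmul p y)"
      by (simp only: zsmul.scale_left_distrib zsmul.scale_scale[symmetric] zsmul_of_nat)
    also have "\<dots> = zsmul u x + (zsmul v (nsmul p y) - zsmul u (x - zsmul k y))"
      by (simp only: zsmul.scale_right_diff_distrib) (simp add: algebra_simps)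
    also have "\<dots> \<in> zsmul.span (insert x M)"
      by (rule zsmul.span_add[OF zsmul.span_scale[OF zsmul.span_base]
            zsmul.span_diff[OF zsmul.span_scale[OF zsmul.span_base] zsmul.span_scale[OF zsmul.span_base]]])
         (use py k in simp_all)
    finally show ?thesis .
  qed
  then show thesis using that[OF Ms] by blast
qed

text \<open>Coefficients can be reduced modulo \<open>n\<close>, which leaves finitely many
  combinations.\<close>

lemma finite_span_torsion:
  assumes "finite F" "\<And>x. x \<in> F \<Longrightarrow> nsmul n x = 0" and n: "0 < n"
  shows "finite (zsmul.span F)"
  using assms(1,2)
proof (induction F rule: finite_induct)
  case (insert a F)
  have "zsmul.span (insert a F) \<subseteq> (\<lambda>(k, y). zsmul k a + y) ` ({0..<int n} \<times> zsmul.span F)"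
  proof
    fix x assume "x \<in> zsmul.span (insert a F)"
    then obtain k where k: "x - zsmul k a \<in> zsmul.span F" using zsmul.span_breakdown_eq by blast
    have "zsmul (k - k mod int n) a = 0"
      using insert.prems by (intro zsmul_eq_0_dvd[of n]) (auto simp: minus_mod_eq_mult_div)
    then have "zsmul k a = zsmul (k mod int n) a" by (simp add: zsmul.scale_left_diff_distrib)
    then have "x = (\<lambda>(k, y). zsmul k a + y) (k mod int n, x - zsmul k a)" by simp
    moreover have "k mod int n \<in> {0..<int n}" using n by auto
    ultimately show "x \<in> (\<lambda>(k, y). zsmul k a + y) ` ({0..<int n} \<times> zsmul.span F)" using k by blast
  qed
  then show ?case using insert by (auto intro: finite_subset)
qed simp

text \<open>If \<open>p\<close>-multiples and \<open>F\<close> generate \<open>S\<close>, then iterating shows that \<open>F\<close> alone does, as \<open>p\<^sup>e S = 0\<close>.\<close>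
lemma span_of_generators_mod_p:
  assumes S: "S \<subseteq> zsmul.span (nsmul p ` S \<union> F)" and e: "\<And>x. x \<in> S \<Longrightarrow> nsmul (p ^ e) x = 0"
  shows "S \<subseteq> zsmul.span F"
proof -
  have "S \<subseteq> zsmul.span (nsmul (p ^ j) ` S \<union> F)" for j
  proof (induction j)
    case 0
    have "nsmul (p ^ 0) ` S = S" by simp
    then show ?case using zsmul.span_superset[of "S \<union> F"] by simp
  next
    case (Suc j)
    let ?W = "zsmul.span (nsmul (p ^ Suc j) ` S \<union> F)"
    define V where "V = {x. nsmul p x \<in> ?W}"
    have "zsmul.subspace V"
      by (rule zsmul_subspaceI)
         (auto simp: V_def nsmul_distrib nsmul_minus zsmul.span_zero intro: zsmul.span_add zsmul.span_neg)
    moreover have "nsmul (p ^ j) ` S \<union> F \<subseteq> V"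
    proof -
      have "nsmul p x \<in> ?W" if "x \<in> F" for x
        using that zsmul.span_scale[OF zsmul.span_base[of x "nsmul (p ^ Suc j) ` S \<union> F"], of "int p"] by simp
      moreover have "nsmul p (nsmul (p ^ j) x) \<in> ?W" if "x \<in> S" for x
        using that by (intro zsmul.span_base) (auto simp: nsmul_mult)
      ultimately show ?thesis by (auto simp: V_def)
    qed
    ultimately have "S \<subseteq> V" using Suc zsmul.span_minimal by blast
    then have "nsmul p ` S \<union> F \<subseteq> ?W"
      using zsmul.span_superset[of "nsmul (p ^ Suc j) ` S \<union> F"] by (auto simp: V_def)
    then have "zsmul.span (nsmul p ` S \<union> F) \<subseteq> ?W"
      by (intro zsmul.span_minimal zsmul.subspace_span)
    with S show ?case by blast
  qed
  from this[of e] have "S \<subseteq> zsmul.span (nsmul (p ^ e) ` S \<union> F)" .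
  also have "nsmul (p ^ e) ` S \<union> F \<subseteq> zsmul.span F"
    using e zsmul.span_superset[of F] by (auto simp: zsmul.span_zero)
  then have "zsmul.span (nsmul (p ^ e) ` S \<union> F) \<subseteq> zsmul.span F"
    by (intro zsmul.span_minimal zsmul.subspace_span)
  finally show ?thesis .
qed

text \<open>\<open>K\<close> starts at \<open>S\<close> and is shrunk by index \<open>p\<close>, one
  new generator at a time, while it keeps containing all \<open>p\<close>-multiples. The descent can
  only stop at \<open>K = H\<close>.\<close>

lemma elementary_quotient:
  fixes S :: "'a::ab_group_add set"
  assumes S: "zsmul.subspace S" and p: "prime p" and e: "\<And>x. x \<in> S \<Longrightarrow> nsmul (p ^ e) x = 0"
    and r: "(r = 1 \<and> S \<noteq> {0}) \<or> infinite S"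
  shows "\<exists>K g. quotient_decomp S K p (replicate r 1) g"
proof -
  define H where "H = nsmul p ` S"
  have Hs: "zsmul.subspace H"
  proof (rule zsmul_subspaceI)
    show "0 \<in> H" using zsmul.subspace_0[OF S] by (force simp: H_def)
    show "- x \<in> H" if "x \<in> H" for x
      using that zsmul.subspace_neg[OF S] by (auto simp: H_def nsmul_minus[symmetric])
    show "x + y \<in> H" if "x \<in> H" "y \<in> H" for x y
      using that zsmul.subspace_add[OF S] by (auto simp: H_def nsmul_distrib[symmetric])
  qed
  have HS: "H \<subseteq> S" using nsmul_in_subspace[OF S] by (auto simp: H_def)
  have "\<exists>K g. quotient_decomp S K p (replicate n 1) g \<and> H \<subseteq> K \<and> K \<subseteq> S" if "n \<le> r" for n
    using that
  proof (induction n)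
    case 0
    then show ?case using S HS zsmul.span_superset[of S]
      by (intro exI[of _ S]) (auto simp: quotient_decomp_def)
  next
    case (Suc n)
    then obtain K g where D: "quotient_decomp S K p (replicate n 1) g" and K: "H \<subseteq> K" "K \<subseteq> S" by auto
    have Ks: "zsmul.subspace K" and gS: "\<And>i. i < n \<Longrightarrow> g i \<in> S"
      and gen: "S \<subseteq> zsmul.span (K \<union> g ` {..<n})"
      and ind: "\<And>c. (\<And>i. i < n \<Longrightarrow> c i < p) \<Longrightarrow> (\<Sum>i<n. nsmul (c i) (g i)) \<in> K \<Longrightarrow> \<forall>i<n. c i = 0"
      using D by (auto simp: quotient_decomp_def)
    \<comment> \<open>Otherwise the finitely many \<open>g i\<close> generate \<open>S\<close>,
      which makes it finite; in the case \<open>r = 1\<close> there is no \<open>g i\<close> yet, so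
      \<open>S\<close> would be trivial.\<close>
    have "K \<noteq> H"
    proof
      assume "K = H"
      then have sub: "S \<subseteq> zsmul.span (g ` {..<n})"
        using span_of_generators_mod_p[of S p "g ` {..<n}" e] gen e by (simp add: H_def)
      have "finite (zsmul.span (g ` {..<n}))"
        using e gS prime_gt_0_nat[OF p] by (intro finite_span_torsion[of _ "p ^ e"]) auto
      with sub have "finite S" by (rule finite_subset)
      with r have "r = 1" "S \<noteq> {0}" by auto
      with Suc.prems sub have "S \<subseteq> {0}" by simp
      with \<open>S \<noteq> {0}\<close> show False using zsmul.subspace_0[OF S] by auto
    qed
    then obtain x where x: "x \<in> K" "x \<notin> H" using K by auto
    have pS: "nsmul p y \<in> H" if "y \<in> S" for y using that by (simp add: H_def)
    obtain M where M: "zsmul.subspace M" "H \<subseteq> M" "M \<subseteq> K" "x \<notin> M" "K \<subseteq> zsmul.span (insert x M)"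
      using maximal_subgroup_avoiding[OF Hs K(1) Ks p _ x] pS K(2) by blast
    define g' where "g' = g(n := x)"
    have xS: "x \<in> S" using x K by auto
    have img: "g' ` {..<Suc n} = insert x (g ` {..<n})"
      by (auto simp: g'_def image_iff less_Suc_eq)
    have g'S: "g' i \<in> S" if "i < Suc n" for i using that gS xS by (auto simp: g'_def less_Suc_eq)
    have "quotient_decomp S M p (replicate (Suc n) 1) g'"
      unfolding quotient_decomp_def
    proof (intro conjI allI impI)
      fix i assume "i < length (replicate (Suc n) (1::nat))"
      then have i: "i < Suc n" by simp
      then show "g' i \<in> S" by (rule g'S)
      have "nsmul p (g' i) \<in> M" using pS[OF g'S[OF i]] M(2) by blast
      moreover have "replicate (Suc n) (1::nat) ! i = 1" using i by (rule nth_replicate)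
      ultimately show "nsmul (p ^ (replicate (Suc n) 1 ! i)) (g' i) \<in> M" by simp
    next
      let ?V = "zsmul.span (M \<union> g' ` {..<length (replicate (Suc n) (1::nat))})"
      have "insert x M \<subseteq> ?V" and g: "g ` {..<n} \<subseteq> ?V"
        using zsmul.span_superset[of "M \<union> g' ` {..<Suc n}"] by (auto simp: img)
      then have "zsmul.span (insert x M) \<subseteq> ?V" by (intro zsmul.span_minimal zsmul.subspace_span)
      then have "K \<union> g ` {..<n} \<subseteq> ?V" using M(5) g by blast
      then have "zsmul.span (K \<union> g ` {..<n}) \<subseteq> ?V" by (intro zsmul.span_minimal zsmul.subspace_span)
      then show "S \<subseteq> ?V" using gen by blast
    next
      fix c i
      assume c: "(\<forall>i<length (replicate (Suc n) (1::nat)). c i < p ^ (replicate (Suc n) 1 ! i)) \<and>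
          (\<Sum>i<length (replicate (Suc n) (1::nat)). nsmul (c i) (g' i)) \<in> M"
        and i: "i < length (replicate (Suc n) (1::nat))"
      have cp: "c i < p" if "i < Suc n" for i
        using c that nth_replicate[OF that, of "1::nat"] by (auto simp del: replicate_Suc)
      have g'g: "(\<Sum>i<n. nsmul (c i) (g' i)) = (\<Sum>i<n. nsmul (c i) (g i))"
        by (intro sum.cong) (auto simp: g'_def)
      then have sum: "(\<Sum>i<n. nsmul (c i) (g i)) + nsmul (c n) x \<in> M"
        using c by (simp add: g'_def)
      \<comment> \<open>Since \<open>x\<close> lies in \<open>K\<close>, removing its multiple
        leaves a combination of the old generators in \<open>K\<close>, to which their independence
        applies.\<close>
      then have "(\<Sum>i<n. nsmul (c i) (g i)) + nsmul (c n) x - nsmul (c n) x \<in> K"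
        using M(3) by (intro zsmul.subspace_diff[OF Ks] nsmul_in_subspace[OF Ks x(1)]) auto
      then have z: "\<forall>i<n. c i = 0" using cp by (intro ind) auto
      then have cn: "nsmul (c n) x \<in> M" using sum by simp
      have "c n = 0"
      proof (rule ccontr)
        assume "c n \<noteq> 0"
        then have "\<not> p dvd c n" using cp[of n] by (auto dest: dvd_imp_le)
        then have "coprime p (c n)" using p by (intro prime_imp_coprime) auto
        moreover have "nsmul p x \<in> M" using pS[OF xS] M(2) by blast
        ultimately have "x \<in> M" using coprime_nsmul_mem[OF M(1)] cn by blast
        with M(4) show False by simp
      qed
      with z i show "c i = 0" by (auto simp: less_Suc_eq)
    qed (use S M in auto)
    moreover have "M \<subseteq> S" using M(3) K(2) by blast
    ultimately show ?case using M(2) by blast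
  qed
  then show ?thesis by blast
qed

section \<open>Values of the maximal degree\<close>

lemma gexp_finiteE:
  assumes "gexp S \<noteq> \<infinity>"
  obtains n where "1 \<le> n" "gexp S = enat n" "\<And>x. x \<in> S \<Longrightarrow> nsmul n x = 0"
    "\<And>m. 1 \<le> m \<Longrightarrow> m < n \<Longrightarrow> \<exists>x\<in>S. nsmul m x \<noteq> 0"
proof -
  let ?P = "\<lambda>n. 1 \<le> n \<and> (\<forall>x\<in>S. nsmul n x = 0)"
  have ex: "\<exists>n. ?P n" using assms by (auto simp: gexp_def split: if_splits)
  define n where "n = (LEAST n. ?P n)"
  have "?P n" unfolding n_def by (rule LeastI_ex[OF ex])
  moreover have "\<not> ?P m" if "m < n" for m using not_less_Least that unfolding n_def by blast
  moreover have "gexp S = enat n" using ex by (simp add: gexp_def n_def)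
  ultimately show thesis using that by blast
qed

lemma ppart_bounded:
  assumes p: "prime p" and "gexp (ppart p :: 'a::ab_group_add set) \<noteq> \<infinity>"
  shows "\<exists>e. \<forall>x\<in>(ppart p :: 'a set). nsmul (p ^ e) x = 0"
proof -
  obtain n where n: "1 \<le> n" "\<And>x. x \<in> (ppart p :: 'a set) \<Longrightarrow> nsmul n x = 0"
    by (rule gexp_finiteE[OF assms(2)], rule that)
  obtain e m where m: "n = p ^ e * m" and "coprime m p"
    using prime_power_decompose[OF p n(1)] .
  have "nsmul (p ^ e) x = 0" if x: "x \<in> ppart p" for x :: 'a
  proof (rule ppart_nsmul_eq_0[OF nsmul_in_subspace[OF subspace_ppart x] \<open>coprime m p\<close>])
    have "n = m * p ^ e" using m by (simp only: mult.commute)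
    then show "nsmul m (nsmul (p ^ e) x) = 0" using n(2)[OF x] nsmul_mult[of m "p ^ e" x] by metis
  qed
  then show ?thesis by blast
qed

lemma ppart_order_exponent:
  assumes "b \<in> ppart p" "nsmul (p ^ N) b \<noteq> 0"
  obtains \<beta> where "N < \<beta>" "nsmul (p ^ \<beta>) b = 0" "nsmul (p ^ (\<beta> - 1)) b \<noteq> 0"
proof -
  have ex: "\<exists>k. nsmul (p ^ k) b = 0" using assms by (auto simp: ppart_def)
  define \<beta> where "\<beta> = (LEAST k. nsmul (p ^ k) b = 0)"
  have \<beta>: "nsmul (p ^ \<beta>) b = 0" unfolding \<beta>_def by (rule LeastI_ex[OF ex])
  have "N < \<beta>"
  proof (rule ccontr)
    assume "\<not> N < \<beta>"
    then obtain d where "N = d + \<beta>" by (metis le_add_diff_inverse2 not_less)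
    then show False using assms(2) \<beta> by (simp add: power_add nsmul_mult)
  qed
  moreover then have "\<beta> - 1 < (LEAST k. nsmul (p ^ k) b = 0)" unfolding \<beta>_def[symmetric] by simp
  then have "nsmul (p ^ (\<beta> - 1)) b \<noteq> 0" by (rule not_less_Least)
  ultimately show thesis using \<beta> that by blast
qed

text \<open>Common source of the three infinite cases: the bound grows with the prime
  \<open>p\<close>, with the order of \<open>b\<close> through \<open>N\<close>, and with the rank
  \<open>r\<close>.\<close>

lemma delta0_ppart_ge_elementary:
  assumes p: "prime p" and e: "gexp (ppart p :: 'a::ab_group_add set) \<noteq> \<infinity>"
    and r: "(r = 1 \<and> (ppart p :: 'a set) \<noteq> {0}) \<or> (1 \<le> r \<and> infinite (ppart p :: 'a set))"
    and b: "b \<in> ppart p" "nsmul (p ^ N) (b :: 'b::ab_group_add) \<noteq> 0"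
  shows "ereal (real ((r + N) * (p - 1))) \<le> delta0 (ppart p :: 'a set) (ppart p :: 'b set)"
proof -
  obtain \<beta> where \<beta>: "N < \<beta>" "nsmul (p ^ \<beta>) b = 0" "nsmul (p ^ (\<beta> - 1)) b \<noteq> 0"
    using ppart_order_exponent[OF b] .
  obtain e where "\<And>x. x \<in> (ppart p :: 'a set) \<Longrightarrow> nsmul (p ^ e) x = 0"
    using ppart_bounded[OF p e] by blast
  then obtain K and g :: "nat \<Rightarrow> 'a" where D: "quotient_decomp (ppart p) K p (replicate r 1) g"
    using elementary_quotient[OF subspace_ppart p, where e = e and r = r] r by blast
  have r0: "r \<noteq> 0" using r by auto
  have "sorted_wrt (\<ge>) (replicate r (1::nat))" by (induction r) auto
  then have "ereal (real (top_degree p (replicate r 1) \<beta>)) \<le> delta0 (ppart p :: 'a set) (ppart p :: 'b set)"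
    using r0 \<beta>(1) b(1) zsmul.subspace_0[OF subspace_ppart]
    by (intro delta0_ge_top_degree[OF D p _ _ _ _ \<beta>(2,3)]) auto
  moreover have "top_degree p (replicate r 1) \<beta> = r * (p - 1) + (\<beta> - 1) * (p - 1)"
    using r0 by (simp add: top_degree_def)
  moreover have "N * (p - 1) \<le> (\<beta> - 1) * (p - 1)" using \<beta>(1) by (intro mult_le_mono1) simp
  then have "(r + N) * (p - 1) \<le> r * (p - 1) + (\<beta> - 1) * (p - 1)"
    by (simp only: add_mult_distrib add_le_cancel_left)
  ultimately show ?thesis by (metis ereal_less_eq(3) of_nat_le_iff order_trans)
qed

lemma cyclic_decomp_imp_quotient_decomp:
  assumes S: "zsmul.subspace S" and p: "0 < p" and D: "cyclic_decomp S p as"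
  shows "\<exists>g. quotient_decomp S {0} p as g"
proof -
  let ?C = "{c. \<forall>i. (i < length as \<longrightarrow> c i < p ^ (as ! i)) \<and> (length as \<le> i \<longrightarrow> c i = 0)}"
  obtain g where g: "\<forall>i<length as. g i \<in> S \<and> nsmul (p ^ (as ! i)) (g i) = 0"
    and bij: "bij_betw (\<lambda>c. \<Sum>i<length as. nsmul (c i) (g i)) ?C S"
    using D by (auto simp: cyclic_decomp_def)
  have "S \<subseteq> zsmul.span ({0} \<union> g ` {..<length as})"
  proof
    fix x assume "x \<in> S"
    then obtain c where "x = (\<Sum>i<length as. nsmul (c i) (g i))"
      using bij by (auto simp: bij_betw_def)
    also have "\<dots> \<in> zsmul.span ({0} \<union> g ` {..<length as})"
      by (intro zsmul.span_sum nsmul_in_subspace zsmul.subspace_span zsmul.span_base) auto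
    finally show "x \<in> zsmul.span ({0} \<union> g ` {..<length as})" .
  qed
  moreover have "\<forall>i<length as. c i = 0"
    if c: "\<forall>i<length as. c i < p ^ (as ! i)" "(\<Sum>i<length as. nsmul (c i) (g i)) = 0" for c
  proof -
    \<comment> \<open>The bijection in \<open>cyclic_decomp\<close> lives on functions vanishing
      beyond the list, so \<open>c\<close> is cut off there.\<close>
    let ?c = "\<lambda>i. if i < length as then c i else 0"
    have "?c = (\<lambda>i. 0)"
      by (rule inj_onD[OF bij_betw_imp_inj_on[OF bij]]) (use c p in auto)
    then show ?thesis by (metis)
  qed
  ultimately show ?thesis using S g by (auto simp: quotient_decomp_def)
qed

lemma delta0_ppart_eq:
  assumes p: "prime p" and A: "(ppart p :: 'a::ab_group_add set) \<noteq> {0}"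
    and B: "(ppart p :: 'b::ab_group_add set) \<noteq> {0}"
    and dec: "cyclic_decomp (ppart p :: 'a set) p as" "sorted_wrt (\<ge>) as" "\<forall>a\<in>set as. 1 \<le> a"
    and \<beta>: "gexp (ppart p :: 'b set) = enat (p ^ \<beta>)"
  shows "delta0 (ppart p :: 'a set) (ppart p :: 'b set) = ereal (real (top_degree p as \<beta>))"
proof -
  obtain g where D: "quotient_decomp (ppart p :: 'a set) {0} p as g"
    using cyclic_decomp_imp_quotient_decomp[OF subspace_ppart prime_gt_0_nat[OF p] dec(1)] by blast
  have as: "as \<noteq> []"
  proof
    assume "as = []"
    then have "(ppart p :: 'a set) \<subseteq> zsmul.span {0}" using D by (simp add: quotient_decomp_def)
    also have "zsmul.span {0} = {0::'a}" by simp
    finally have "(ppart p :: 'a set) \<subseteq> {0}" .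
    with A show False using zsmul.subspace_0[OF subspace_ppart] by auto
  qed
  have T0: "0 \<in> (ppart p :: 'b set)" by (rule zsmul.subspace_0[OF subspace_ppart])
  have fin: "gexp (ppart p :: 'b set) \<noteq> \<infinity>" using \<beta> by simp
  obtain n where n: "gexp (ppart p :: 'b set) = enat n" "\<And>x. x \<in> (ppart p :: 'b set) \<Longrightarrow> nsmul n x = 0"
    "\<And>m. 1 \<le> m \<Longrightarrow> m < n \<Longrightarrow> \<exists>x\<in>(ppart p :: 'b set). nsmul m x \<noteq> 0"
    by (rule gexp_finiteE[OF fin], rule that)
  have n': "n = p ^ \<beta>" using n(1) \<beta> by simp
  have \<beta>1: "1 \<le> \<beta>"
  proof (rule ccontr)
    assume "\<not> 1 \<le> \<beta>"
    then have "n = Suc 0" by (simp add: n')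
    then have "(ppart p :: 'b set) \<subseteq> {0}" using n(2) by auto
    with B T0 show False by auto
  qed
  \<comment> \<open>Minimality of the exponent provides an element of order exactly
    \<open>p ^ \<beta>\<close>.\<close>
  have "p ^ (\<beta> - 1) < p ^ \<beta>"
    using \<beta>1 prime_gt_1_nat[OF p] by (intro power_strict_increasing) auto
  then obtain b :: 'b where b: "b \<in> ppart p" "nsmul (p ^ (\<beta> - 1)) b \<noteq> 0"
    using n(3)[of "p ^ (\<beta> - 1)"] n' prime_gt_0_nat[OF p] by auto
  show ?thesis
  proof (rule antisym)
    show "ereal (real (top_degree p as \<beta>)) \<le> delta0 (ppart p :: 'a set) (ppart p :: 'b set)"
      using n(2)[OF b(1)] n' by (intro delta0_ge_top_degree[OF D p as dec(2,3) \<beta>1 _ b(2) T0 b(1)]) simp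
    show "delta0 (ppart p :: 'a set) (ppart p :: 'b set) \<le> ereal (real (top_degree p as \<beta>))"
    proof (rule delta0_leI)
      fix f :: "'a \<Rightarrow> 'b" assume f: "f ` ppart p \<subseteq> ppart p"
      \<comment> \<open>\<open>invariant_maps\<close> constrains values on the whole type; extension
        by zero meets this and leaves the degree on \<open>ppart p\<close> unchanged.\<close>
      define h where "h = (\<lambda>x. if x \<in> ppart p then f x else 0)"
      have "h \<in> invariant_maps {0} (ppart p)" using f T0 by (auto simp: h_def invariant_maps_def)
      then have "fdeg_le (ppart p) h (top_degree p as \<beta>)"
        using n(2) n' by (intro fdeg_le_top_degree[OF D p subspace_ppart _ \<beta>1 _ dec(2,3)]) auto
      moreover have "fdeg_le (ppart p) f m = fdeg_le (ppart p) h m" for m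
        by (rule fdeg_le_cong[OF subspace_ppart]) (simp add: h_def)
      ultimately show "fdeg (ppart p) f \<le> ereal (real (top_degree p as \<beta>))"
        by (intro fdeg_le_imp_fdeg) simp
    qed
  qed
qed

lemma delta0_le_0_if_trivial:
  assumes "S = {0} \<or> T = {0}"
  shows "delta0 S T \<le> 0"
proof (rule delta0_leI)
  fix f :: "'a \<Rightarrow> 'b" assume f: "f ` S \<subseteq> T"
  show "fdeg S f \<le> 0"
  proof (cases "T = {0}")
    case True
    then show ?thesis using f by (auto simp: fdeg_def)
  next
    case False
    then have "fdeg_le S f 0"
      using assms by (auto simp: fdeg_le_def length_Suc_conv diffs_Cons diffop_def)
    then show ?thesis using fdeg_le_imp_fdeg[of S f 0] by (simp add: zero_ereal_def)
  qed
qed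

theorem theorem3p10:
  assumes ntA: "(UNIV :: 'a::ab_group_add set) \<noteq> {0}"
      and ntB: "(UNIV :: 'b::ab_group_add set) \<noteq> {0}"
      and torA: "torsion_group TYPE('a)"
      and torB: "torsion_group TYPE('b)"
      and expA: "\<forall>p::nat. prime p \<longrightarrow> gexp (ppart p :: 'a set) \<noteq> \<infinity>"
  shows
   "delta0 (UNIV :: 'a set) (UNIV :: 'b set)
      = (SUP p\<in>{p::nat. prime p}. delta0 (ppart p :: 'a set) (ppart p :: 'b set))
    \<and> (infinite {p::nat. prime p \<and> (ppart p :: 'a set) \<noteq> {0} \<and> (ppart p :: 'b set) \<noteq> {0}}
         \<longrightarrow> delta0 (UNIV :: 'a set) (UNIV :: 'b set) = \<infinity>)
    \<and> ((\<exists>p::nat. prime p \<and> (ppart p :: 'a set) \<noteq> {0} \<and> gexp (ppart p :: 'b set) = \<infinity>)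
         \<longrightarrow> delta0 (UNIV :: 'a set) (UNIV :: 'b set) = \<infinity>)
    \<and> ((\<exists>p::nat. prime p \<and> infinite (ppart p :: 'a set) \<and> (ppart p :: 'b set) \<noteq> {0})
         \<longrightarrow> delta0 (UNIV :: 'a set) (UNIV :: 'b set) = \<infinity>)
    \<and> (\<forall>(\<alpha> :: nat \<Rightarrow> nat list) (\<beta> :: nat \<Rightarrow> nat).
         let P = {p::nat. prime p \<and> (ppart p :: 'a set) \<noteq> {0} \<and> (ppart p :: 'b set) \<noteq> {0}} in
         finite P
         \<and> (\<forall>p\<in>P. finite (ppart p :: 'a set) \<and> gexp (ppart p :: 'b set) \<noteq> \<infinity>)
         \<and> (\<forall>p\<in>P. cyclic_decomp (ppart p :: 'a set) p (\<alpha> p)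
                   \<and> sorted_wrt (\<ge>) (\<alpha> p) \<and> (\<forall>a\<in>set (\<alpha> p). a \<ge> 1)
                   \<and> gexp (ppart p :: 'b set) = enat (p ^ \<beta> p))
         \<longrightarrow> delta0 (UNIV :: 'a set) (UNIV :: 'b set) < \<infinity>
           \<and> delta0 (UNIV :: 'a set) (UNIV :: 'b set)
               = ereal (real (Max ({0} \<union>
                   (\<lambda>p. (\<Sum>i<length (\<alpha> p). p ^ (\<alpha> p ! i) - 1)
                        + (\<beta> p - 1) * (p - 1) * p ^ (hd (\<alpha> p) - 1)) ` P))))"
proof -
  let ?D = "delta0 (UNIV :: 'a set) (UNIV :: 'b set)"
  let ?P = "{p::nat. prime p \<and> (ppart p :: 'a set) \<noteq> {0} \<and> (ppart p :: 'b set) \<noteq> {0}}"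
  note SUP = delta0_eq_SUP_ppart[OF ntB torA torB]
  have nonzero: "\<exists>b\<in>ppart p. b \<noteq> (0::'b)" if "(ppart p :: 'b set) \<noteq> {0}" for p
    using that zsmul.subspace_0[OF subspace_ppart] by blast
  have ge: "ereal (real ((r + N) * (p - 1))) \<le> ?D"
    if "prime p" "(r = 1 \<and> (ppart p :: 'a set) \<noteq> {0}) \<or> (1 \<le> r \<and> infinite (ppart p :: 'a set))"
      "b \<in> ppart p" "nsmul (p ^ N) (b :: 'b) \<noteq> 0" for p r N b
    using delta0_ppart_ge_elementary[OF that(1) _ that(2-4)] expA that(1)
      delta0_ppart_le[OF torA that(1)] order_trans by blast
  have inf: "?D = \<infinity>" if "\<And>n::nat. ereal (real n) \<le> ?D"
  proof (rule ereal_top)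
    fix B :: real
    obtain n :: nat where "B \<le> real n" using real_arch_simple by blast
    then show "ereal B \<le> ?D" using that[of n] by (metis ereal_less_eq(3) order_trans)
  qed
  have mono: "ereal (real n) \<le> ?D" if "ereal (real m) \<le> ?D" "n \<le> m" for m n :: nat
    using that by (metis ereal_less_eq(3) of_nat_le_iff order_trans)
  \<comment> \<open>With rank one and \<open>N = 0\<close> the bound \<open>p - 1\<close> grows with
    the prime.\<close>
  have b: "?D = \<infinity>" if infP: "infinite ?P"
  proof (rule inf)
    fix n :: nat
    obtain p where p: "p \<in> ?P" "n < p" using infP by (meson infinite_nat_iff_unbounded)
    obtain b :: 'b where "b \<in> ppart p" "b \<noteq> 0" using nonzero p by blast
    then have "ereal (real ((1 + 0) * (p - 1))) \<le> ?D" using p by (intro ge) auto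
    then show "ereal (real n) \<le> ?D" by (rule mono) (use p in simp)
  qed
  \<comment> \<open>With rank one, \<open>N\<close> can be arbitrarily large, as no power of
    \<open>p\<close> kills the second \<open>p\<close>-part.\<close>
  have c: "?D = \<infinity>" if p: "prime p" "(ppart p :: 'a set) \<noteq> {0}" "gexp (ppart p :: 'b set) = \<infinity>" for p
  proof (rule inf)
    fix n :: nat
    have p2: "2 \<le> p" using p(1) by (rule prime_ge_2_nat)
    have "\<not> (\<forall>x\<in>(ppart p :: 'b set). nsmul (p ^ n) x = 0)"
      using p(3) p2 by (auto simp: gexp_def split: if_splits)
    then obtain b :: 'b where "b \<in> ppart p" "nsmul (p ^ n) b \<noteq> 0" by blast
    then have "ereal (real ((1 + n) * (p - 1))) \<le> ?D" using p by (intro ge) auto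
    moreover have "(1 + n) * 1 \<le> (1 + n) * (p - 1)" using p2 by (intro mult_le_mono2) simp
    then have "n \<le> (1 + n) * (p - 1)" by simp
    ultimately show "ereal (real n) \<le> ?D" by (rule mono)
  qed
  \<comment> \<open>With \<open>N = 0\<close>, the rank \<open>r\<close> can be arbitrarily
    large.\<close>
  have d: "?D = \<infinity>" if p: "prime p" "infinite (ppart p :: 'a set)" "(ppart p :: 'b set) \<noteq> {0}" for p
  proof (rule inf)
    fix n :: nat
    have p2: "2 \<le> p" using p(1) by (rule prime_ge_2_nat)
    obtain b :: 'b where "b \<in> ppart p" "b \<noteq> 0" using nonzero p by blast
    then have "ereal (real ((Suc n + 0) * (p - 1))) \<le> ?D" using p by (intro ge) auto
    moreover have "Suc n * 1 \<le> Suc n * (p - 1)" using p2 by (intro mult_le_mono2) simp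
    then have "n \<le> (Suc n + 0) * (p - 1)" by simp
    ultimately show "ereal (real n) \<le> ?D" by (rule mono)
  qed
  have e: "?D < \<infinity> \<and> ?D = ereal (real (Max ({0} \<union> (\<lambda>p. (\<Sum>i<length (\<alpha> p). p ^ (\<alpha> p ! i) - 1)
                        + (\<beta> p - 1) * (p - 1) * p ^ (hd (\<alpha> p) - 1)) ` ?P)))"
    if fin: "finite ?P" and dec: "\<forall>p\<in>?P. cyclic_decomp (ppart p :: 'a set) p (\<alpha> p)
                   \<and> sorted_wrt (\<ge>) (\<alpha> p) \<and> (\<forall>a\<in>set (\<alpha> p). a \<ge> 1)
                   \<and> gexp (ppart p :: 'b set) = enat (p ^ \<beta> p)"
    for \<alpha> :: "nat \<Rightarrow> nat list" and \<beta> :: "nat \<Rightarrow> nat"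
  proof -
    define t where "t p = top_degree p (\<alpha> p) (\<beta> p)" for p
    define M where "M = Max ({0} \<union> t ` ?P)"
    have eq: "delta0 (ppart p :: 'a set) (ppart p :: 'b set) = ereal (real (t p))" if "p \<in> ?P" for p
      unfolding t_def using that dec by (intro delta0_ppart_eq) auto
    have "?D = ereal (real M)"
    proof (rule antisym)
      show "?D \<le> ereal (real M)"
        unfolding SUP
      proof (rule SUP_least)
        fix p :: nat assume p: "p \<in> {p. prime p}"
        show "delta0 (ppart p :: 'a set) (ppart p :: 'b set) \<le> ereal (real M)"
        proof (cases "p \<in> ?P")
          case True
          then have "t p \<le> M" unfolding M_def using fin by (intro Max_ge) auto
          then show ?thesis by (simp add: eq[OF True])
        next
          case False
          then have "delta0 (ppart p :: 'a set) (ppart p :: 'b set) \<le> 0"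
            using p by (intro delta0_le_0_if_trivial) auto
          then show ?thesis by (rule order_trans) simp
        qed
      qed
      have "M \<in> {0} \<union> t ` ?P" unfolding M_def using fin by (intro Max_in) auto
      \<comment> \<open>The value \<open>0\<close> is attained by a nonzero constant map, any other
        maximum at a prime in \<open>?P\<close>.\<close>
      then consider "M = 0" | p where "p \<in> ?P" "M = t p" by blast
      then show "ereal (real M) \<le> ?D"
      proof cases
        case 1
        obtain b :: 'b where "b \<noteq> 0" using ntB by auto
        then show ?thesis using delta0_ge_0[of b "UNIV :: 'b set" "UNIV :: 'a set"]
          unfolding 1 by (simp add: zero_ereal_def)
      next
        case 2
        then show ?thesis using eq[of p] delta0_ppart_le[OF torA, of p, where 'b = 'b] by simp
      qed
    qed
    then show ?thesis unfolding M_def t_def top_degree_def by simp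
  qed
  show ?thesis
    unfolding Let_def
  proof (intro conjI impI allI)
    show "?D = \<infinity>" if "infinite ?P" using that by (rule b)
    show "?D = \<infinity>" if "\<exists>p::nat. prime p \<and> (ppart p :: 'a set) \<noteq> {0} \<and> gexp (ppart p :: 'b set) = \<infinity>"
      using that c by blast
    show "?D = \<infinity>" if "\<exists>p::nat. prime p \<and> infinite (ppart p :: 'a set) \<and> (ppart p :: 'b set) \<noteq> {0}"
      using that d by blast
  \<comment> \<open>The goals left are the splitting into primary components and the two conjuncts
    of the explicit finite case.\<close>
  qed (rule SUP, (elim conjE, rule e[THEN conjunct1], assumption+), (elim conjE, rule e[THEN conjunct2], assumption+))
qed

end
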